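(* Let $\mathfrak g$ be a quasi-triangular Lie bialgebra with an r-matrix $r$, let $f:\mathfrak g\to V$ be a surjective homomorphism of $\mathfrak g$-modules ($\mathfrak g$ being the adjoint module), let $\mathfrak t=V\rtimes\mathfrak g$, and let $\widehat r=(f\otimes\mathrm{id}_{\mathfrak g}+\mathrm{id}_{\mathfrak g}\otimes f)(r)\in\mathfrak t\otimes\mathfrak t$. Then: (a) $\mathfrak t$ is a quasi-triangular Lie bialgebra with the r-matrix $\widehat r$, and $\widehat{\delta_r}=\delta_{\widehat r}$. (b) If $r+\tau(r)=0$ then for any $\mathfrak g$-invariant $\Omega\in(V\otimes V)^{\mathfrak g}$, $\{\widehat r+\lambda\Omega\}_{\lambda\in\Bbbk}$ is a family of classical r-matrices for the same Lie cobracket $\delta_{\widehat r}$ on $\mathfrak t$.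
   Context: The base field $\Bbbk$ has characteristic zero. For a Lie algebra $\mathfrak l$, $\Delta$ is the standard comultiplication of $U(\mathfrak l)$, $\mathfrak l\otimes\mathfrak l\subset U(\mathfrak l)\otimes U(\mathfrak l)$; $\tau=\tau_{1,2}$ and $\tau_{i,j}$ swaps tensor factors $i$ and $j$. For $s\in\mathfrak l\otimes\mathfrak l$, $s_{i,j}\in U(\mathfrak l)^{\otimes3}$ has the first factor of $s$ in position $i$, the second in position $j$ and $1$ elsewhere; $\delta_s:\mathfrak l\to\mathfrak l\otimes\mathfrak l$ is $\delta_s(x)=[s,\Delta(x)]$. A Lie cobracket on $\mathfrak l$ is a linear map $\delta:\mathfrak l\to\mathfrak l\otimes\mathfrak l$ with $\delta([x,y])=[\delta(x),\Delta(y)]-[\delta(y),\Delta(x)]$, $\tau_{1,2}\circ\delta=-\delta$ and $(\mathrm{id}+\tau_{1,2}\tau_{2,3}+\tau_{2,3}\tau_{1,2})\circ(\delta\otimes\mathrm{id})\circ\delta=0$. A Lie bialgebra $(\mathfrak l,\delta)$ is quasi-triangular with classical r-matrix $s$ if $\delta=\delta_s$ and $[s_{1,2},s_{1,3}]+[s_{1,2},s_{2,3}]+[s_{1,3},s_{2,3}]=0$. $\mathfrak t=V\rtimes\mathfrak g$ is $V\oplus\mathfrak g$ with the bracket $[(v,x),(v',x')]=(xv'-x'v,[x,x'])$, so that $\mathfrak g$ is a subalgebra and $V$ an abelian ideal. For the cobracket $\delta=\delta_r$ on $\mathfrak g$, $\widehat\delta:\mathfrak t\to\mathfrak t\otimes\mathfrak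 t$ is the linear map defined by $\widehat\delta(x)=(f\otimes\mathrm{id}_{\mathfrak g}+\mathrm{id}_{\mathfrak g}\otimes f)(\delta(x))$ and $\widehat\delta(f(x))=(f\otimes f)(\delta(x))$ for $x\in\mathfrak g$. *)

theory Defs
  imports "HOL-Library.Poly_Mapping" "HOL-Analysis.Product_Vector"
begin

text \<open>
  Conventions. A vector space over the field \<open>'k\<close> is a type together with a scalar
  multiplication (locale \<^locale>\<open>vector_space\<close>). Tensor products and enveloping algebras
  are quotients \<open>A/N\<close> of a vector space \<open>A\<close> (a type) by a subspace \<open>N\<close>. As there are no
  dependent types, an element of \<open>A/N\<close> is given by a representative in \<open>A\<close>, and equality
  in \<open>A/N\<close> is congruence modulo \<open>N\<close>, written \<open>eq_mod N\<close>. Quantifying over all elements of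
  \<open>A/N\<close> is quantifying over all representatives, and a map into \<open>A/N\<close> is a map into \<open>A\<close>
  of which the properties are required modulo \<open>N\<close>.
\<close>

definition eq_mod :: "'a::ab_group_add set \<Rightarrow> 'a \<Rightarrow> 'a \<Rightarrow> bool"
  where "eq_mod N x y \<longleftrightarrow> x - y \<in> N"

section \<open>Free vector spaces\<close>

text \<open>The free vector space on the type \<open>'x\<close> is \<open>'x \<Rightarrow>\<^sub>0 'k\<close>, with basis vectors \<open>single x 1\<close>.\<close>

definition fv_scale :: "'k::field \<Rightarrow> ('x \<Rightarrow>\<^sub>0 'k) \<Rightarrow> ('x \<Rightarrow>\<^sub>0 'k)"
  where "fv_scale c = Poly_Mapping.map ((*) c)"

lemma lookup_fv_scale [simp]: "Poly_Mapping.lookup (fv_scale c p) x = c * Poly_Mapping.lookup p x"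
  by (simp add: fv_scale_def Poly_Mapping.map.rep_eq when_def)

lemma vector_space_fv_scale: "vector_space (fv_scale :: 'k::field \<Rightarrow> ('x \<Rightarrow>\<^sub>0 'k) \<Rightarrow> _)"
  by unfold_locales
    (auto intro!: poly_mapping_eqI simp: lookup_add algebra_simps)

abbreviation fv_span :: "('x \<Rightarrow>\<^sub>0 'k::field) set \<Rightarrow> ('x \<Rightarrow>\<^sub>0 'k) set"
  where "fv_span \<equiv> module.span fv_scale"

text \<open>The linear map with prescribed values on the basis; with \<open>fv_map\<close> the case where basis
  vectors are sent to basis vectors, and \<open>fv_mult\<close> the bilinear extension of a binary operation.\<close>

definition fv_extend :: "('x \<Rightarrow> ('y \<Rightarrow>\<^sub>0 'k)) \<Rightarrow> ('x \<Rightarrow>\<^sub>0 'k::field) \<Rightarrow> ('y \<Rightarrow>\<^sub>0 'k)"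
  where "fv_extend h p =
    (\<Sum>x\<in>Poly_Mapping.keys p. fv_scale (Poly_Mapping.lookup p x) (h x))"

definition fv_map :: "('x \<Rightarrow> 'y) \<Rightarrow> ('x \<Rightarrow>\<^sub>0 'k::field) \<Rightarrow> ('y \<Rightarrow>\<^sub>0 'k)"
  where "fv_map h = fv_extend (\<lambda>x. Poly_Mapping.single (h x) 1)"

definition fv_mult :: "('x \<Rightarrow> 'x \<Rightarrow> 'x) \<Rightarrow> ('x \<Rightarrow>\<^sub>0 'k::field) \<Rightarrow> ('x \<Rightarrow>\<^sub>0 'k) \<Rightarrow> ('x \<Rightarrow>\<^sub>0 'k)"
  where "fv_mult op p q = fv_extend (\<lambda>x. fv_map (op x) q) p"

section \<open>Tensor squares and cubes\<close>

text \<open>Relations making \<open>a \<mapsto> single (i a) 1\<close> linear on \<open>A\<close> (with scalar multiplication \<open>s\<close>)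
  and zero on \<open>N\<close>.\<close>

definition slot_rels ::
    "('k::field \<Rightarrow> 'a::ab_group_add \<Rightarrow> 'a) \<Rightarrow> 'a set \<Rightarrow> ('a \<Rightarrow> 'x) \<Rightarrow> ('x \<Rightarrow>\<^sub>0 'k) set"
  where "slot_rels s N i =
     {Poly_Mapping.single (i (a + b)) 1 - Poly_Mapping.single (i a) 1 - Poly_Mapping.single (i b) 1 | a b. True}
   \<union> {Poly_Mapping.single (i (s c a)) 1 - fv_scale c (Poly_Mapping.single (i a) 1) | c a. True}
   \<union> {Poly_Mapping.single (i a) 1 | a. a \<in> N}"

text \<open>For \<open>M = A/N\<close>, the spaces \<open>M \<otimes> M\<close> and \<open>M \<otimes> M \<otimes> M\<close> are the quotients of the free vector
  spaces on \<open>A \<times> A\<close> and \<open>A \<times> A \<times> A\<close> by the following subspaces; \<open>single (a, b) 1\<close> represents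
  the pure tensor of the classes of \<open>a\<close> and \<open>b\<close>.\<close>

definition tensor2_null ::
    "('k::field \<Rightarrow> 'a::ab_group_add \<Rightarrow> 'a) \<Rightarrow> 'a set \<Rightarrow> ('a \<times> 'a \<Rightarrow>\<^sub>0 'k) set"
  where "tensor2_null s N = fv_span
    (\<Union>b. slot_rels s N (\<lambda>a. (a, b)) \<union> slot_rels s N (\<lambda>a. (b, a)))"

definition tensor3_null ::
    "('k::field \<Rightarrow> 'a::ab_group_add \<Rightarrow> 'a) \<Rightarrow> 'a set \<Rightarrow> ('a \<times> 'a \<times> 'a \<Rightarrow>\<^sub>0 'k) set"
  where "tensor3_null s N = fv_span
    (\<Union>b c. slot_rels s N (\<lambda>a. (a, b, c)) \<union> slot_rels s N (\<lambda>a. (b, a, c))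
      \<union> slot_rels s N (\<lambda>a. (b, c, a)))"

text \<open>For linear \<open>f\<close> and \<open>g\<close>, \<open>fv_map (map_prod f g)\<close> is the map \<open>f \<otimes> g\<close>.\<close>

definition tau :: "('a \<times> 'a \<Rightarrow>\<^sub>0 'k::field) \<Rightarrow> ('a \<times> 'a \<Rightarrow>\<^sub>0 'k)"
  where "tau = fv_map (\<lambda>(a, b). (b, a))"

definition tau12 :: "('a \<times> 'a \<times> 'a \<Rightarrow>\<^sub>0 'k::field) \<Rightarrow> ('a \<times> 'a \<times> 'a \<Rightarrow>\<^sub>0 'k)"
  where "tau12 = fv_map (\<lambda>(a, b, c). (b, a, c))"

definition tau23 :: "('a \<times> 'a \<times> 'a \<Rightarrow>\<^sub>0 'k::field) \<Rightarrow> ('a \<times> 'a \<times> 'a \<Rightarrow>\<^sub>0 'k)"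
  where "tau23 = fv_map (\<lambda>(a, b, c). (a, c, b))"

text \<open>The map \<open>d \<otimes> id\<close> for \<open>d : M \<rightarrow> M \<otimes> M\<close>.\<close>

definition tensor_id :: "('a \<Rightarrow> ('a \<times> 'a \<Rightarrow>\<^sub>0 'k)) \<Rightarrow> ('a \<times> 'a \<Rightarrow>\<^sub>0 'k::field) \<Rightarrow> ('a \<times> 'a \<times> 'a \<Rightarrow>\<^sub>0 'k)"
  where "tensor_id d = fv_extend (\<lambda>(a, b). fv_map (\<lambda>(a1, a2). (a1, a2, b)) (d a))"

section \<open>Lie algebras and enveloping algebras\<close>

locale lie_algebra = vector_space scale
  for scale :: "'k::field_char_0 \<Rightarrow> 'l::ab_group_add \<Rightarrow> 'l" +
  fixes bracket :: "'l \<Rightarrow> 'l \<Rightarrow> 'l"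
  assumes linear_bracket_left: "\<And>y. Vector_Spaces.linear scale scale (\<lambda>x. bracket x y)"
    and linear_bracket_right: "\<And>x. Vector_Spaces.linear scale scale (\<lambda>y. bracket x y)"
    and bracket_self: "\<And>x. bracket x x = 0"
    and jacobi: "\<And>x y z. bracket x (bracket y z) + bracket y (bracket z x)
                          + bracket z (bracket x y) = 0"

text \<open>The free associative algebra on the set \<open>'l\<close> has the words in \<open>'l\<close> as a basis.
  The enveloping algebra is its quotient by the two-sided ideal generated by the
  relations of linearity of the generators (the quotient by these alone being the tensor algebra)
  and by \<open>xy - yx - [x,y]\<close>.\<close>

type_synonym ('l, 'k) free_alg = "'l list \<Rightarrow>\<^sub>0 'k"

definition fa_gen :: "'l \<Rightarrow> ('l, 'k::field) free_alg"
  where "fa_gen x = Poly_Mapping.single [x] 1"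

definition fa_one :: "('l, 'k::field) free_alg"
  where "fa_one = Poly_Mapping.single [] 1"

definition fa_mult :: "('l, 'k::field) free_alg \<Rightarrow> ('l, 'k) free_alg \<Rightarrow> ('l, 'k) free_alg"
  where "fa_mult = fv_mult (@)"

definition U_rels ::
    "('k::field \<Rightarrow> 'l::ab_group_add \<Rightarrow> 'l) \<Rightarrow> ('l \<Rightarrow> 'l \<Rightarrow> 'l) \<Rightarrow> ('l, 'k) free_alg set"
  where "U_rels s br = slot_rels s {} (\<lambda>x. [x])
    \<union> {fa_mult (fa_gen x) (fa_gen y) - fa_mult (fa_gen y) (fa_gen x) - fa_gen (br x y) | x y. True}"

definition U_null ::
    "('k::field \<Rightarrow> 'l::ab_group_add \<Rightarrow> 'l) \<Rightarrow> ('l \<Rightarrow> 'l \<Rightarrow> 'l) \<Rightarrow> ('l, 'k) free_alg set"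
  where "U_null s br = fv_span {fa_mult (fa_mult u g) v | u g v. g \<in> U_rels s br}"

text \<open>The null spaces for \<open>U(\<ll>) \<otimes> U(\<ll>)\<close> and \<open>U(\<ll>) \<otimes> U(\<ll>) \<otimes> U(\<ll>)\<close>, and the componentwise
  products and commutators there.\<close>

definition UU_null ::
    "('k::field \<Rightarrow> 'l::ab_group_add \<Rightarrow> 'l) \<Rightarrow> ('l \<Rightarrow> 'l \<Rightarrow> 'l)
      \<Rightarrow> (('l, 'k) free_alg \<times> ('l, 'k) free_alg \<Rightarrow>\<^sub>0 'k) set"
  where "UU_null s br = tensor2_null fv_scale (U_null s br)"

definition UUU_null ::
    "('k::field \<Rightarrow> 'l::ab_group_add \<Rightarrow> 'l) \<Rightarrow> ('l \<Rightarrow> 'l \<Rightarrow> 'l)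
      \<Rightarrow> (('l, 'k) free_alg \<times> ('l, 'k) free_alg \<times> ('l, 'k) free_alg \<Rightarrow>\<^sub>0 'k) set"
  where "UUU_null s br = tensor3_null fv_scale (U_null s br)"

definition mult2 ::
    "(('l, 'k::field) free_alg \<times> ('l, 'k) free_alg \<Rightarrow>\<^sub>0 'k)
      \<Rightarrow> (('l, 'k) free_alg \<times> ('l, 'k) free_alg \<Rightarrow>\<^sub>0 'k)
      \<Rightarrow> (('l, 'k) free_alg \<times> ('l, 'k) free_alg \<Rightarrow>\<^sub>0 'k)"
  where "mult2 = fv_mult (\<lambda>(a, b) (a', b'). (fa_mult a a', fa_mult b b'))"

definition mult3 ::
    "(('l, 'k::field) free_alg \<times> ('l, 'k) free_alg \<times> ('l, 'k) free_alg \<Rightarrow>\<^sub>0 'k)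
      \<Rightarrow> (('l, 'k) free_alg \<times> ('l, 'k) free_alg \<times> ('l, 'k) free_alg \<Rightarrow>\<^sub>0 'k)
      \<Rightarrow> (('l, 'k) free_alg \<times> ('l, 'k) free_alg \<times> ('l, 'k) free_alg \<Rightarrow>\<^sub>0 'k)"
  where "mult3 = fv_mult
    (\<lambda>(a, b, c) (a', b', c'). (fa_mult a a', fa_mult b b', fa_mult c c'))"

definition comm2 ::
    "(('l, 'k::field) free_alg \<times> ('l, 'k) free_alg \<Rightarrow>\<^sub>0 'k)
      \<Rightarrow> (('l, 'k) free_alg \<times> ('l, 'k) free_alg \<Rightarrow>\<^sub>0 'k)
      \<Rightarrow> (('l, 'k) free_alg \<times> ('l, 'k) free_alg \<Rightarrow>\<^sub>0 'k)"
  where "comm2 p q = mult2 p q - mult2 q p"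

definition comm3 ::
    "(('l, 'k::field) free_alg \<times> ('l, 'k) free_alg \<times> ('l, 'k) free_alg \<Rightarrow>\<^sub>0 'k)
      \<Rightarrow> (('l, 'k) free_alg \<times> ('l, 'k) free_alg \<times> ('l, 'k) free_alg \<Rightarrow>\<^sub>0 'k)
      \<Rightarrow> (('l, 'k) free_alg \<times> ('l, 'k) free_alg \<times> ('l, 'k) free_alg \<Rightarrow>\<^sub>0 'k)"
  where "comm3 p q = mult3 p q - mult3 q p"

text \<open>The comultiplication: the algebra homomorphism with \<open>x \<mapsto> x \<otimes> 1 + 1 \<otimes> x\<close> on generators.\<close>

definition comult ::
    "('l, 'k::field) free_alg \<Rightarrow> (('l, 'k) free_alg \<times> ('l, 'k) free_alg \<Rightarrow>\<^sub>0 'k)"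
  where "comult = fv_extend (\<lambda>w. foldr
    (\<lambda>x. mult2 (Poly_Mapping.single (fa_gen x, fa_one) 1 + Poly_Mapping.single (fa_one, fa_gen x) 1))
    w (Poly_Mapping.single (fa_one, fa_one) 1))"

text \<open>The inclusion of \<open>\<ll> \<otimes> \<ll>\<close> into \<open>U(\<ll>) \<otimes> U(\<ll>)\<close>, and the elements \<open>s\<^sub>1\<^sub>2\<close>, \<open>s\<^sub>1\<^sub>3\<close>, \<open>s\<^sub>2\<^sub>3\<close>.\<close>

definition incl2 :: "('l \<times> 'l \<Rightarrow>\<^sub>0 'k::field) \<Rightarrow> (('l, 'k) free_alg \<times> ('l, 'k) free_alg \<Rightarrow>\<^sub>0 'k)"
  where "incl2 = fv_map (map_prod fa_gen fa_gen)"

definition leg12 ::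
    "('l \<times> 'l \<Rightarrow>\<^sub>0 'k::field) \<Rightarrow> (('l, 'k) free_alg \<times> ('l, 'k) free_alg \<times> ('l, 'k) free_alg \<Rightarrow>\<^sub>0 'k)"
  where "leg12 = fv_map (\<lambda>(a, b). (fa_gen a, fa_gen b, fa_one))"

definition leg13 ::
    "('l \<times> 'l \<Rightarrow>\<^sub>0 'k::field) \<Rightarrow> (('l, 'k) free_alg \<times> ('l, 'k) free_alg \<times> ('l, 'k) free_alg \<Rightarrow>\<^sub>0 'k)"
  where "leg13 = fv_map (\<lambda>(a, b). (fa_gen a, fa_one, fa_gen b))"

definition leg23 ::
    "('l \<times> 'l \<Rightarrow>\<^sub>0 'k::field) \<Rightarrow> (('l, 'k) free_alg \<times> ('l, 'k) free_alg \<times> ('l, 'k) free_alg \<Rightarrow>\<^sub>0 'k)"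
  where "leg23 = fv_map (\<lambda>(a, b). (fa_one, fa_gen a, fa_gen b))"

section \<open>Lie bialgebras\<close>

abbreviation LL_null :: "('k::field \<Rightarrow> 'l::ab_group_add \<Rightarrow> 'l) \<Rightarrow> ('l \<times> 'l \<Rightarrow>\<^sub>0 'k) set"
  where "LL_null s \<equiv> tensor2_null s {}"

abbreviation LLL_null :: "('k::field \<Rightarrow> 'l::ab_group_add \<Rightarrow> 'l) \<Rightarrow> ('l \<times> 'l \<times> 'l \<Rightarrow>\<^sub>0 'k) set"
  where "LLL_null s \<equiv> tensor3_null s {}"

definition linear_into_square ::
    "('k::field \<Rightarrow> 'l::ab_group_add \<Rightarrow> 'l) \<Rightarrow> ('l \<Rightarrow> ('l \<times> 'l \<Rightarrow>\<^sub>0 'k)) \<Rightarrow> bool"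
  where "linear_into_square s d \<longleftrightarrow>
    (\<forall>x y. eq_mod (LL_null s) (d (x + y)) (d x + d y)) \<and>
    (\<forall>c x. eq_mod (LL_null s) (d (s c x)) (fv_scale c (d x)))"

locale lie_bialgebra = lie_algebra scale bracket
  for scale :: "'k::field_char_0 \<Rightarrow> 'l::ab_group_add \<Rightarrow> 'l" and bracket +
  fixes cobracket :: "'l \<Rightarrow> ('l \<times> 'l \<Rightarrow>\<^sub>0 'k)"
  assumes linear_cobracket: "linear_into_square scale cobracket"
    and cocycle: "\<And>x y. eq_mod (UU_null scale bracket) (incl2 (cobracket (bracket x y)))
          (comm2 (incl2 (cobracket x)) (comult (fa_gen y))
            - comm2 (incl2 (cobracket y)) (comult (fa_gen x)))"
    and coantisymmetry: "\<And>x. eq_mod (LL_null scale) (tau (cobracket x)) (- cobracket x)"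
    and cojacobi: "\<And>x. let p = tensor_id cobracket (cobracket x) in
          eq_mod (LLL_null scale) (p + tau12 (tau23 p) + tau23 (tau12 p)) 0"

text \<open>\<open>\<delta>\<^sub>s(x) = [s, \<Delta>(x)]\<close> in \<open>U(\<ll>) \<otimes> U(\<ll>)\<close>; \<open>is_delta s br t d\<close> expresses \<open>d = \<delta>\<^sub>t\<close> for a
  map \<open>d : \<ll> \<rightarrow> \<ll> \<otimes> \<ll>\<close>.\<close>

definition delta :: "('l \<times> 'l \<Rightarrow>\<^sub>0 'k::field) \<Rightarrow> 'l \<Rightarrow> (('l, 'k) free_alg \<times> ('l, 'k) free_alg \<Rightarrow>\<^sub>0 'k)"
  where "delta t x = comm2 (incl2 t) (comult (fa_gen x))"

definition is_delta ::
    "('k::field \<Rightarrow> 'l::ab_group_add \<Rightarrow> 'l) \<Rightarrow> ('l \<Rightarrow> 'l \<Rightarrow> 'l) \<Rightarrow> ('l \<times> 'l \<Rightarrow>\<^sub>0 'k)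
      \<Rightarrow> ('l \<Rightarrow> ('l \<times> 'l \<Rightarrow>\<^sub>0 'k)) \<Rightarrow> bool"
  where "is_delta s br t d \<longleftrightarrow> (\<forall>x. eq_mod (UU_null s br) (incl2 (d x)) (delta t x))"

locale quasi_triangular = lie_bialgebra scale bracket cobracket
  for scale :: "'k::field_char_0 \<Rightarrow> 'l::ab_group_add \<Rightarrow> 'l" and bracket cobracket +
  fixes r :: "'l \<times> 'l \<Rightarrow>\<^sub>0 'k"
  assumes cobracket_eq_delta: "is_delta scale bracket r cobracket"
    and cybe: "eq_mod (UUU_null scale bracket)
          (comm3 (leg12 r) (leg13 r) + comm3 (leg12 r) (leg23 r) + comm3 (leg13 r) (leg23 r)) 0"

section \<open>Modules and semidirect products\<close>

locale lie_module = lie_algebra scale bracket + V: vector_space scaleV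
  for scale :: "'k::field_char_0 \<Rightarrow> 'l::ab_group_add \<Rightarrow> 'l" and bracket
    and scaleV :: "'k \<Rightarrow> 'v::ab_group_add \<Rightarrow> 'v" +
  fixes act :: "'l \<Rightarrow> 'v \<Rightarrow> 'v"
  assumes linear_act_left: "\<And>v. Vector_Spaces.linear scale scaleV (\<lambda>x. act x v)"
    and linear_act_right: "\<And>x. Vector_Spaces.linear scaleV scaleV (act x)"
    and act_bracket: "\<And>x y v. act (bracket x y) v = act x (act y v) - act y (act x v)"

text \<open>The scalar multiplication of \<open>V \<oplus> \<gg>\<close> is \<open>module_prod.scale scaleV scale\<close>.\<close>

definition semidirect_bracket ::
    "('l \<Rightarrow> 'l \<Rightarrow> 'l) \<Rightarrow> ('l \<Rightarrow> 'v \<Rightarrow> 'v) \<Rightarrow> 'v \<times> 'l \<Rightarrow> 'v \<times> 'l \<Rightarrow> 'v::ab_group_add \<times> 'l::ab_group_add"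
  where "semidirect_bracket br act = (\<lambda>(v, x) (v', x'). (act x v' - act x' v, br x x'))"

definition inV :: "'v::ab_group_add \<Rightarrow> 'v \<times> 'l::ab_group_add"
  where "inV v = (v, 0)"

definition inL :: "'l::ab_group_add \<Rightarrow> 'v::ab_group_add \<times> 'l"
  where "inL x = (0, x)"

text \<open>The map \<open>f \<otimes> id + id \<otimes> f\<close> from \<open>\<gg> \<otimes> \<gg>\<close> to \<open>\<tt> \<otimes> \<tt>\<close>, where \<open>\<tt> = V \<rtimes> \<gg>\<close>.\<close>

definition hat :: "('l::ab_group_add \<Rightarrow> 'v::ab_group_add) \<Rightarrow> ('l \<times> 'l \<Rightarrow>\<^sub>0 'k::field)
      \<Rightarrow> (('v \<times> 'l) \<times> ('v \<times> 'l) \<Rightarrow>\<^sub>0 'k)"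
  where "hat f p = fv_map (map_prod (inV \<circ> f) inL) p + fv_map (map_prod inL (inV \<circ> f)) p"

text \<open>\<open>is_hat_cobracket s f d h\<close>: \<open>h\<close> is the linear map \<open>\<tt> \<rightarrow> \<tt> \<otimes> \<tt>\<close> derived from \<open>d\<close>, where \<open>s\<close> is the
  scalar multiplication of \<open>\<tt>\<close>. For surjective \<open>f\<close> this determines \<open>h\<close> as a map into \<open>\<tt> \<otimes> \<tt>\<close>.\<close>

definition is_hat_cobracket ::
    "('k::field \<Rightarrow> 'v \<times> 'l \<Rightarrow> 'v \<times> 'l) \<Rightarrow> ('l::ab_group_add \<Rightarrow> 'v::ab_group_add)
      \<Rightarrow> ('l \<Rightarrow> ('l \<times> 'l \<Rightarrow>\<^sub>0 'k)) \<Rightarrow> ('v \<times> 'l \<Rightarrow> (('v \<times> 'l) \<times> ('v \<times> 'l) \<Rightarrow>\<^sub>0 'k)) \<Rightarrow> bool"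
  where "is_hat_cobracket s f d h \<longleftrightarrow> linear_into_square s h \<and>
    (\<forall>x. eq_mod (LL_null s) (h (inL x)) (hat f (d x))) \<and>
    (\<forall>x. eq_mod (LL_null s) (h (inV (f x))) (fv_map (map_prod (inV \<circ> f) (inV \<circ> f)) (d x)))"

definition invariant2 ::
    "('k::field \<Rightarrow> 'v::ab_group_add \<Rightarrow> 'v) \<Rightarrow> ('l \<Rightarrow> 'v \<Rightarrow> 'v) \<Rightarrow> ('v \<times> 'v \<Rightarrow>\<^sub>0 'k) \<Rightarrow> bool"
  where "invariant2 s act w \<longleftrightarrow>
    (\<forall>x. eq_mod (LL_null s) (fv_map (map_prod (act x) id) w + fv_map (map_prod id (act x)) w) 0)"

end

theory Submission
  imports Defs "HOL-Combinatorics.Multiset_Permutations"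
begin

text \<open>
  The map \<open>\<ll> \<rightarrow> U(\<ll>)\<close> is injective, with a linear retraction obtained by evaluating words in \<open>\<ll>\<close>.
  Tensoring the retraction shows that \<open>\<ll> \<otimes> \<ll>\<close> and \<open>\<ll> \<otimes> \<ll> \<otimes> \<ll>\<close> embed into the tensor powers of
  \<open>U(\<ll>)\<close>, so that the axioms of a quasi-triangular Lie bialgebra become identities between tensors
  over \<open>\<ll>\<close>.

  The map \<open>x + y\<epsilon> \<mapsto> x + f(y)\<close> is a Lie algebra homomorphism from \<open>\<gg>[\<epsilon>]/(\<epsilon>\<^sup>2)\<close> onto \<open>\<tt>\<close>.
  Writing \<open>\<epsilon>\<^sub>i\<close> for \<open>\<epsilon>\<close> in the tensor factor \<open>i\<close>, the element \<open>r\<^sub>h = hat f r\<close> is the image of \<open>(\<epsilon>\<^sub>1 + \<epsilon>\<^sub>2) r\<close>.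
  Since \<open>(\<epsilon>\<^sub>1 + \<epsilon>\<^sub>2)(\<epsilon>\<^sub>1 + \<epsilon>\<^sub>3)\<close>, \<open>(\<epsilon>\<^sub>1 + \<epsilon>\<^sub>2)(\<epsilon>\<^sub>2 + \<epsilon>\<^sub>3)\<close> and \<open>(\<epsilon>\<^sub>1 + \<epsilon>\<^sub>3)(\<epsilon>\<^sub>2 + \<epsilon>\<^sub>3)\<close> all equal
  \<open>e\<^sub>2 = \<epsilon>\<^sub>1\<epsilon>\<^sub>2 + \<epsilon>\<^sub>1\<epsilon>\<^sub>3 + \<epsilon>\<^sub>2\<epsilon>\<^sub>3\<close>, the Yang--Baxter expression of \<open>r\<^sub>h\<close> is \<open>e\<^sub>2\<close> times that of \<open>r\<close>;
  likewise the co-Jacobi expression is multiplied by \<open>e\<^sub>2\<close> on \<open>\<gg>\<close> and by \<open>\<epsilon>\<^sub>1\<epsilon>\<^sub>2\<epsilon>\<^sub>3\<close> on \<open>V\<close>.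
  For invariant \<open>\<Omega>\<close> the terms of the Yang--Baxter expression quadratic in \<open>\<Omega>\<close> vanish as \<open>V\<close> is abelian,
  and the mixed terms cancel by invariance and the skew-symmetry of \<open>r\<close>.
\<close>

section \<open>The embedding of a Lie algebra into its enveloping algebra\<close>

context lie_algebra
begin

section \<open>Elementary identities of the bracket\<close>

lemma bracket_add_left: "bracket (x + y) z = bracket x z + bracket y z"
  using linear_bracket_left by (simp add: Vector_Spaces.linear_iff)

lemma bracket_add_right: "bracket z (x + y) = bracket z x + bracket z y"
  using linear_bracket_right by (simp add: Vector_Spaces.linear_iff)

lemma bracket_scale_left: "bracket (scale c x) z = scale c (bracket x z)"
  using linear_bracket_left by (simp add: Vector_Spaces.linear_iff)

lemma bracket_scale_right: "bracket z (scale c x) = scale c (bracket z x)"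
  using linear_bracket_right by (simp add: Vector_Spaces.linear_iff)

lemma bracket_antisym: "bracket y x = - bracket x y"
proof -
  have "bracket x y + bracket y x = bracket (x + y) (x + y)"
    by (simp only: bracket_add_left bracket_add_right) (simp add: bracket_self)
  then show ?thesis by (simp add: bracket_self add_eq_0_iff)
qed

lemma bracket_minus_right: "bracket x (- y) = - bracket x y"
  using bracket_scale_right[of x "-1" y] by simp

lemma bracket_zero_left [simp]: "bracket 0 y = 0"
  using bracket_scale_left[of 0 0 y] by simp

lemma bracket_zero_right [simp]: "bracket x 0 = 0"
  using bracket_scale_right[of x 0 0] by simp

text \<open>The Jacobi identity in the form in which its three double brackets arise when three
  neighbouring letters are sorted in the two possible ways.\<close>

lemma bracket_jacobi:
  "bracket x (bracket y z) + bracket (bracket x z) y + bracket z (bracket x y) = 0"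
proof -
  have "bracket (bracket x z) y = bracket y (bracket z x)"
    by (metis bracket_antisym bracket_minus_right minus_minus)
  then show ?thesis using jacobi[of x y z] by simp
qed

section \<open>Multilinear evaluations of words\<close>

definition multilinear_on :: "nat \<Rightarrow> ('l list \<Rightarrow> 'l) \<Rightarrow> bool"
  where "multilinear_on n p \<longleftrightarrow> (\<forall>u v c a b. length u + length v + 1 = n \<longrightarrow>
    p (u @ (scale c a + b) # v) = scale c (p (u @ a # v)) + p (u @ b # v))"

text \<open>The relation xy - yx = [x,y] of the enveloping algebra, under an evaluation
  \<open>p\<close> of words of length \<open>n\<close> and an evaluation \<open>q\<close> of words
  one letter shorter.\<close>

definition swap_rule :: "nat \<Rightarrow> ('l list \<Rightarrow> 'l) \<Rightarrow> ('l list \<Rightarrow> 'l) \<Rightarrow> bool"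
  where "swap_rule n p q \<longleftrightarrow> (\<forall>u v x y. length u + length v + 2 = n \<longrightarrow>
    p (u @ x # y # v) = p (u @ y # x # v) + q (u @ bracket x y # v))"

lemma multilinear_onD:
  "multilinear_on n p \<Longrightarrow> length u + length v + 1 = n \<Longrightarrow>
    p (u @ (scale c a + b) # v) = scale c (p (u @ a # v)) + p (u @ b # v)"
  unfolding multilinear_on_def by blast

lemma multilinear_on_add:
  assumes "multilinear_on n p" "length u + length v + 1 = n"
  shows "p (u @ (a + b) # v) = p (u @ a # v) + p (u @ b # v)"
  using multilinear_onD[OF assms, of 1] by simp

lemma multilinear_on_zero:
  assumes "multilinear_on n p" "length u + length v + 1 = n"
  shows "p (u @ 0 # v) = 0"
  using multilinear_onD[OF assms, of 1 0 0] by simp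

lemma multilinear_on_scale:
  assumes "multilinear_on n p" "length u + length v + 1 = n"
  shows "p (u @ scale c a # v) = scale c (p (u @ a # v))"
  using multilinear_onD[OF assms, of c a 0] multilinear_on_zero[OF assms] by simp

lemma multilinear_on_minus:
  assumes "multilinear_on n p" "length u + length v + 1 = n"
  shows "p (u @ (- a) # v) = - p (u @ a # v)"
  using multilinear_on_scale[OF assms, of "-1"] by simp

lemma swap_ruleD:
  "swap_rule n p q \<Longrightarrow> length u + length v + 2 = n \<Longrightarrow>
    p (u @ x # y # v) = p (u @ y # x # v) + q (u @ bracket x y # v)"
  unfolding swap_rule_def by blast

text \<open>The letters of a word are labelled by natural numbers, \<open>e\<close> assigns to a label its letter.
  Sorting the labels by adjacent transpositions, the transposition of neighbours \<open>x\<close>, \<open>y\<close>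
  costs \<open>p\<close> of the word with \<open>xy\<close> replaced by \<open>[x,y]\<close>. If \<open>p\<close> evaluates the words of length \<open>n\<close>,
  the cost of sorting, averaged over all labellings of the positions, evaluates the words of
  length \<open>n + 1\<close>. The labels make the path of the sorting independent of the letters, so that the
  cost is multilinear; the average makes it independent of the labelling.\<close>

primrec insert_cost :: "('l list \<Rightarrow> 'l) \<Rightarrow> (nat \<Rightarrow> 'l) \<Rightarrow> 'l list \<Rightarrow> nat \<Rightarrow> nat list \<Rightarrow> 'l"
  where "insert_cost p e u x [] = 0"
  | "insert_cost p e u x (y # ys) = (if x \<le> y then 0
      else p (u @ bracket (e x) (e y) # map e ys) + insert_cost p e (u @ [e y]) x ys)"

primrec sort_cost :: "('l list \<Rightarrow> 'l) \<Rightarrow> (nat \<Rightarrow> 'l) \<Rightarrow> 'l list \<Rightarrow> nat list \<Rightarrow> 'l"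
  where "sort_cost p e u [] = 0"
  | "sort_cost p e u (x # xs) = sort_cost p e (u @ [e x]) xs + insert_cost p e u x (sort xs)"

text \<open>By the swap rule each transposition costs exactly the difference of \<open>p\<close>
  before and after it, so the sum telescopes.\<close>

lemma insert_cost_telescope:
  assumes R: "swap_rule n p q" and "length u + length ys + 1 = n"
  shows "insert_cost q e u x ys = p (u @ e x # map e ys) - p (u @ map e (insort x ys))"
  using assms(2)
proof (induction ys arbitrary: u)
  case (Cons y ys)
  have "insert_cost q e (u @ [e y]) x ys
      = p (u @ e y # e x # map e ys) - p (u @ e y # map e (insort x ys))"
    using Cons.IH[of "u @ [e y]"] Cons.prems by simp
  moreover have "p (u @ e x # e y # map e ys)
      = p (u @ e y # e x # map e ys) + q (u @ bracket (e x) (e y) # map e ys)"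
    using Cons.prems by (intro swap_ruleD[OF R]) simp
  ultimately show ?case by simp
qed simp

lemma sort_cost_telescope:
  assumes R: "swap_rule n p q" and "length u + length xs = n"
  shows "sort_cost q e u xs = p (u @ map e xs) - p (u @ map e (sort xs))"
  using assms(2)
proof (induction xs arbitrary: u)
  case (Cons x xs)
  have "sort_cost q e (u @ [e x]) xs = p (u @ e x # map e xs) - p (u @ e x # map e (sort xs))"
    using Cons.IH[of "u @ [e x]"] Cons.prems by simp
  moreover have "insert_cost q e u x (sort xs)
      = p (u @ e x # map e (sort xs)) - p (u @ map e (insort x (sort xs)))"
    using Cons.prems by (intro insert_cost_telescope[OF R]) simp
  ultimately show ?case by simp
qed simp

text \<open>Every summand is \<open>p\<close> of a word with \<open>a\<close> and \<open>b\<close>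
  as neighbours in the prefix already passed. The swap rule applies to each and leaves the cost of
  the same path with \<open>bracket a b\<close> in their place.\<close>

lemma insert_cost_swap:
  assumes R: "swap_rule n p q" and "length u + length v + length ys + 2 = n"
  shows "insert_cost p e (u @ a # b # v) x ys
    = insert_cost p e (u @ b # a # v) x ys + insert_cost q e (u @ bracket a b # v) x ys"
  using assms(2)
proof (induction ys arbitrary: v)
  case (Cons y ys)
  have "insert_cost p e (u @ a # b # (v @ [e y])) x ys
    = insert_cost p e (u @ b # a # (v @ [e y])) x ys
      + insert_cost q e (u @ bracket a b # (v @ [e y])) x ys"
    using Cons.prems by (intro Cons.IH) simp
  moreover have "p (u @ a # b # (v @ bracket (e x) (e y) # map e ys))
    = p (u @ b # a # (v @ bracket (e x) (e y) # map e ys))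
      + q (u @ bracket a b # (v @ bracket (e x) (e y) # map e ys))"
    using Cons.prems by (intro swap_ruleD[OF R]) simp
  ultimately show ?case by simp
qed simp

lemma sort_cost_swap:
  assumes R: "swap_rule n p q" and "length u + length v + length xs + 1 = n"
  shows "sort_cost p e (u @ a # b # v) xs
    = sort_cost p e (u @ b # a # v) xs + sort_cost q e (u @ bracket a b # v) xs"
  using assms(2)
proof (induction xs arbitrary: v)
  case (Cons x xs)
  have "sort_cost p e (u @ a # b # (v @ [e x])) xs
    = sort_cost p e (u @ b # a # (v @ [e x])) xs
      + sort_cost q e (u @ bracket a b # (v @ [e x])) xs"
    using Cons.prems by (intro Cons.IH) simp
  moreover have "insert_cost p e (u @ a # b # v) x (sort xs)
    = insert_cost p e (u @ b # a # v) x (sort xs)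
      + insert_cost q e (u @ bracket a b # v) x (sort xs)"
    using Cons.prems by (intro insert_cost_swap[OF R]) simp
  ultimately show ?case by simp
qed simp

text \<open>The two ways around the hexagon have the same cost by the Jacobi identity.\<close>

lemma insert_cost_hexagon:
  assumes R: "swap_rule n p q" and p: "multilinear_on n p"
    and q: "multilinear_on (n - 1) q"
    and "length u + length S + 1 = n" and "x < y"
  shows "insert_cost p e (u @ [e x]) y S + insert_cost p e u x (insort y S)
    = insert_cost p e (u @ [e y]) x S + insert_cost p e u y (insort x S)
      + p (u @ bracket (e x) (e y) # map e S)"
  using assms(4)
proof (induction S arbitrary: u)
  case Nil
  have "p (u @ bracket (e y) (e x) # []) = - p (u @ bracket (e x) (e y) # [])"
    using Nil by (subst bracket_antisym) (auto intro: multilinear_on_minus[OF p])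
  with \<open>x < y\<close> show ?case by simp
next
  case (Cons s S)
  show ?case
  proof (cases "x \<le> s")
    case True
    \<comment> \<open>Insertion of \<open>x\<close> stops at once. The only extra transposition is
      that of \<open>y\<close> and \<open>x\<close>, and antisymmetry cancels it against the last
      term.\<close>
    have "p (u @ bracket (e y) (e x) # e s # map e S)
        = - p (u @ bracket (e x) (e y) # e s # map e S)"
      using Cons.prems by (subst bracket_antisym) (auto intro: multilinear_on_minus[OF p])
    with True \<open>x < y\<close> show ?thesis by simp
  next
    case False
    \<comment> \<open>Here s < x < y, so both labels pass \<open>s\<close>. With \<open>s\<close>
      moved to the front the induction hypothesis applies; moving it there leaves three double
      brackets, whose sum is zero.\<close>
    let ?X = "e x" and ?Y = "e y" and ?Z = "e s" and ?w = "map e S"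
    have IH: "insert_cost p e (u @ [?Z, ?X]) y S + insert_cost p e (u @ [?Z]) x (insort y S)
      = insert_cost p e (u @ [?Z, ?Y]) x S + insert_cost p e (u @ [?Z]) y (insort x S)
        + p (u @ ?Z # bracket ?X ?Y # ?w)"
      using Cons.IH[of "u @ [?Z]"] Cons.prems by simp
    have xs: "insert_cost p e (u @ [?X, ?Z]) y S
      = insert_cost p e (u @ [?Z, ?X]) y S + insert_cost q e (u @ [bracket ?X ?Z]) y S"
      using Cons.prems insert_cost_swap[OF R, of u "[]" S e ?X ?Z y] by simp
    have ys: "insert_cost p e (u @ [?Y, ?Z]) x S
      = insert_cost p e (u @ [?Z, ?Y]) x S + insert_cost q e (u @ [bracket ?Y ?Z]) x S"
      using Cons.prems insert_cost_swap[OF R, of u "[]" S e ?Y ?Z x] by simp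
    have tx: "insert_cost q e (u @ [bracket ?X ?Z]) y S
      = p (u @ bracket ?X ?Z # ?Y # ?w) - p (u @ bracket ?X ?Z # map e (insort y S))"
      using Cons.prems insert_cost_telescope[OF R, of "u @ [bracket ?X ?Z]" S e y] by simp
    have ty: "insert_cost q e (u @ [bracket ?Y ?Z]) x S
      = p (u @ bracket ?Y ?Z # ?X # ?w) - p (u @ bracket ?Y ?Z # map e (insort x S))"
      using Cons.prems insert_cost_telescope[OF R, of "u @ [bracket ?Y ?Z]" S e x] by simp
    have c1: "p (u @ ?X # bracket ?Y ?Z # ?w)
        = p (u @ bracket ?Y ?Z # ?X # ?w) + q (u @ bracket ?X (bracket ?Y ?Z) # ?w)"
      using Cons.prems by (intro swap_ruleD[OF R]) simp
    have c2: "p (u @ bracket ?X ?Z # ?Y # ?w)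
        = p (u @ ?Y # bracket ?X ?Z # ?w) + q (u @ bracket (bracket ?X ?Z) ?Y # ?w)"
      using Cons.prems by (intro swap_ruleD[OF R]) simp
    have c3: "p (u @ ?Z # bracket ?X ?Y # ?w)
        = p (u @ bracket ?X ?Y # ?Z # ?w) + q (u @ bracket ?Z (bracket ?X ?Y) # ?w)"
      using Cons.prems by (intro swap_ruleD[OF R]) simp
    have l: "length u + length ?w + 1 = n - 1"
      using Cons.prems by simp
    have "q (u @ bracket ?X (bracket ?Y ?Z) # ?w) + q (u @ bracket (bracket ?X ?Z) ?Y # ?w)
        + q (u @ bracket ?Z (bracket ?X ?Y) # ?w)
      = q (u @ (bracket ?X (bracket ?Y ?Z) + bracket (bracket ?X ?Z) ?Y
          + bracket ?Z (bracket ?X ?Y)) # ?w)"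
      by (simp add: multilinear_on_add[OF q l])
    also have "\<dots> = 0"
      by (simp add: bracket_jacobi multilinear_on_zero[OF q l])
    finally have J: "q (u @ bracket ?Z (bracket ?X ?Y) # ?w)
        = - q (u @ bracket ?X (bracket ?Y ?Z) # ?w) - q (u @ bracket (bracket ?X ?Z) ?Y # ?w)"
      by (simp add: algebra_simps eq_neg_iff_add_eq_0)
    have c3': "p (u @ bracket ?X ?Y # ?Z # ?w)
        = p (u @ ?Z # bracket ?X ?Y # ?w) - q (u @ bracket ?Z (bracket ?X ?Y) # ?w)"
      using c3 by simp
    have IH': "insert_cost p e (u @ [?Z, ?X]) y S = insert_cost p e (u @ [?Z, ?Y]) x S
        + insert_cost p e (u @ [?Z]) y (insort x S) + p (u @ ?Z # bracket ?X ?Y # ?w)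
        - insert_cost p e (u @ [?Z]) x (insort y S)"
      using IH by (simp add: eq_diff_eq)
    show ?thesis
      using False \<open>x < y\<close> by (simp add: xs ys tx ty c1 c2 c3' IH' J algebra_simps)
  qed
qed

text \<open>Labels move together with their letters, so both words have the same sorted form, and
  transposing \<open>x\<close> and \<open>y\<close> first costs as much as sorting directly. With
  \<open>x\<close> and \<open>y\<close> in front of the sorted tail this is the hexagon; a label
  further left is inserted into the same sorted list in both cases.\<close>

lemma sort_cost_transpose:
  assumes R: "swap_rule n p q" and p: "multilinear_on n p"
    and q: "multilinear_on (n - 1) q"
    and "length u + length a + length b + 1 = n" and "x \<noteq> y"
  shows "sort_cost p e u (a @ x # y # b)
    = sort_cost p e u (a @ y # x # b) + p (u @ map e a @ bracket (e x) (e y) # map e b)"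
  using assms(4)
proof (induction a arbitrary: u)
  case Nil
  let ?S = "sort b"
  have s: "sort_cost p e (u @ [e x, e y]) b
    = sort_cost p e (u @ [e y, e x]) b + sort_cost q e (u @ [bracket (e x) (e y)]) b"
    using Nil sort_cost_swap[OF R, of u "[]" b e "e x" "e y"] by simp
  have t: "sort_cost q e (u @ [bracket (e x) (e y)]) b
    = p (u @ bracket (e x) (e y) # map e b) - p (u @ bracket (e x) (e y) # map e ?S)"
    using Nil sort_cost_telescope[OF R, of "u @ [bracket (e x) (e y)]" b e] by simp
  have h: "insert_cost p e (u @ [e x]) y ?S + insert_cost p e u x (insort y ?S)
    = insert_cost p e (u @ [e y]) x ?S + insert_cost p e u y (insort x ?S)
      + p (u @ bracket (e x) (e y) # map e ?S)"
  proof (cases "x < y")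
    case True
    with Nil show ?thesis by (intro insert_cost_hexagon[OF R p q]) simp_all
  next
    case False
    with \<open>x \<noteq> y\<close> have "y < x" by simp
    moreover have "p (u @ bracket (e y) (e x) # map e ?S)
        = - p (u @ bracket (e x) (e y) # map e ?S)"
      using Nil by (subst bracket_antisym) (auto intro: multilinear_on_minus[OF p])
    ultimately show ?thesis
      using Nil insert_cost_hexagon[OF R p q, of u ?S y x e] by (simp add: algebra_simps)
  qed
  have "insert_cost p e (u @ [e x]) y ?S = insert_cost p e (u @ [e y]) x ?S
      + insert_cost p e u y (insort x ?S) + p (u @ bracket (e x) (e y) # map e ?S)
      - insert_cost p e u x (insort y ?S)"
    using h by (simp add: eq_diff_eq)
  then show ?case by (simp add: s t algebra_simps)
next
  case (Cons z a)
  have "sort (a @ x # y # b) = sort (a @ y # x # b)"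
    by (induction a) (simp_all add: insort_left_comm)
  then show ?case using Cons.IH[of "u @ [e z]"] Cons.prems by simp
qed

text \<open>As the labels are distinct, every summand is \<open>p\<close> of a word in which the
  letter of \<open>k\<close> occurs exactly once: in the passed prefix, inside the bracket or in the
  tail.\<close>

lemma insert_cost_update:
  assumes p: "multilinear_on n p" and "length u + length ys = n"
    and "distinct (u @ x # ys)" and "k \<in> set (u @ x # ys)"
  shows "insert_cost p (e(k := scale c a + b)) (map (e(k := scale c a + b)) u) x ys
    = scale c (insert_cost p (e(k := a)) (map (e(k := a)) u) x ys)
      + insert_cost p (e(k := b)) (map (e(k := b)) u) x ys"
  using assms(2-4)
proof (induction ys arbitrary: u)
  case Nil
  then show ?case by simp
next
  case (Cons y ys)
  let ?e = "\<lambda>t. e(k := t)" 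
  let ?F = "\<lambda>t. p (map (?e t) u @ bracket (?e t x) (?e t y) # map (?e t) ys)"
  have "?F (scale c a + b) = scale c (?F a) + ?F b"
  proof -
    consider "k \<in> set u" | "k = x" | "k = y" | "k \<in> set ys" using Cons.prems by auto
    then show ?thesis
    proof cases
      case 1
      then obtain u1 u2 where u: "u = u1 @ k # u2" by (meson split_list)
      with Cons.prems have [simp]: "\<And>t. map (?e t) u1 = map e u1" "\<And>t. map (?e t) u2 = map e u2"
        "\<And>t. map (?e t) ys = map e ys" "x \<noteq> k" "y \<noteq> k"
        by auto
      show ?thesis
        using multilinear_onD[OF p, of "map e u1" "map e u2 @ bracket (e x) (e y) # map e ys" c a b]
          Cons.prems u by simp
    next
      case 2
      with Cons.prems have [simp]: "\<And>t. map (?e t) u = map e u"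
        "\<And>t. map (?e t) ys = map e ys" "y \<noteq> x" "y \<noteq> k"
        by auto
      show ?thesis
        using multilinear_onD[OF p, of "map e u" "map e ys" c "bracket a (e y)" "bracket b (e y)"]
          Cons.prems 2 by (simp add: bracket_add_left bracket_scale_left)
    next
      case 3
      with Cons.prems have [simp]: "\<And>t. map (?e t) u = map e u"
        "\<And>t. map (?e t) ys = map e ys" "x \<noteq> k" "x \<noteq> y"
        by auto
      show ?thesis
        using multilinear_onD[OF p, of "map e u" "map e ys" c "bracket (e x) a" "bracket (e x) b"]
          Cons.prems 3 by (simp add: bracket_add_right bracket_scale_right)
    next
      case 4
      then obtain u1 u2 where u: "ys = u1 @ k # u2" by (meson split_list)
      with Cons.prems have [simp]: "\<And>t. map (?e t) u1 = map e u1" "\<And>t. map (?e t) u2 = map e u2"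
        "\<And>t. map (?e t) u = map e u" "x \<noteq> k" "y \<noteq> k"
        by auto
      show ?thesis
        using multilinear_onD[OF p, of "map e u @ bracket (e x) (e y) # map e u1" "map e u2" c a b]
          Cons.prems u by simp
    qed
  qed
  moreover have "insert_cost p (?e (scale c a + b)) (map (?e (scale c a + b)) (u @ [y])) x ys
    = scale c (insert_cost p (?e a) (map (?e a) (u @ [y])) x ys)
      + insert_cost p (?e b) (map (?e b) (u @ [y])) x ys"
    using Cons.prems by (intro Cons.IH) auto
  ultimately show ?case by (simp add: algebra_simps del: fun_upd_apply)
qed

lemma sort_cost_update:
  assumes p: "multilinear_on n p" and "length u + length xs = Suc n"
    and "distinct (u @ xs)" and "k \<in> set (u @ xs)"
  shows "sort_cost p (e(k := scale c a + b)) (map (e(k := scale c a + b)) u) xs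
    = scale c (sort_cost p (e(k := a)) (map (e(k := a)) u) xs)
      + sort_cost p (e(k := b)) (map (e(k := b)) u) xs"
  using assms(2-4)
proof (induction xs arbitrary: u)
  case Nil
  then show ?case by simp
next
  case (Cons x xs)
  let ?e = "\<lambda>t. e(k := t)" 
  have "sort_cost p (?e (scale c a + b)) (map (?e (scale c a + b)) (u @ [x])) xs
    = scale c (sort_cost p (?e a) (map (?e a) (u @ [x])) xs)
      + sort_cost p (?e b) (map (?e b) (u @ [x])) xs"
    using Cons.prems by (intro Cons.IH) auto
  moreover have "insert_cost p (?e (scale c a + b)) (map (?e (scale c a + b)) u) x (sort xs)
    = scale c (insert_cost p (?e a) (map (?e a) u) x (sort xs))
      + insert_cost p (?e b) (map (?e b) u) x (sort xs)"
    using Cons.prems by (intro insert_cost_update[OF p]) auto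
  ultimately show ?case by (simp add: algebra_simps del: fun_upd_apply)
qed

section \<open>Labellings and the averaged cost of sorting\<close>

definition label :: "nat list \<Rightarrow> 'l list \<Rightarrow> nat \<Rightarrow> 'l"
  where "label ks w k = the (map_of (zip ks w) k)"

lemma map_label: "distinct ks \<Longrightarrow> length ks = length w \<Longrightarrow> map (label ks w) ks = w"
  by (rule nth_equalityI) (simp_all add: label_def map_of_zip_nth)

lemma label_swap:
  assumes "distinct (a @ k # l # b)" "length a = length u" "length b = length v"
  shows "label (a @ k # l # b) (u @ x # y # v) = label (a @ l # k # b) (u @ y # x # v)"
  using assms by (auto simp: label_def fun_eq_iff fun_upd_twist)

lemma label_update:
  assumes "distinct (a @ k # b)" "length a = length u" "length b = length v"
  shows "label (a @ k # b) (u @ t # v) = (label (a @ k # b) (u @ s # v))(k := t)"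
proof -
  have "k \<notin> dom (map_of (zip a u))" using assms by (simp add: dom_map_of_zip)
  then show ?thesis using assms by (simp add: label_def fun_eq_iff map_add_upd_left)
qed

text \<open>The lists \<open>ks\<close> are the labellings of the positions of \<open>w\<close> by
  the numbers below its length. Dividing by their number uses characteristic zero.\<close>

definition average_cost :: "('l list \<Rightarrow> 'l) \<Rightarrow> 'l list \<Rightarrow> 'l"
  where "average_cost p w = scale (1 / fact (length w))
    (\<Sum>ks\<in>permutations_of_set {..<length w}. sort_cost p (label ks w) [] ks)"

lemma permutations_split:
  assumes "ks \<in> permutations_of_set {..<n}" "i < n"
  obtains a k b where "ks = a @ k # b" "length a = i" "length a + length b + 1 = n" "distinct ks"
proof -
  have n: "length ks = n"
    using length_finite_permutations_of_set[OF assms(1)] by simp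
  then have "ks = take i ks @ ks ! i # drop (Suc i) ks"
    using assms(2) by (simp add: id_take_nth_drop)
  then show ?thesis
    using that[of "take i ks" "ks ! i" "drop (Suc i) ks"] n assms
    by (auto simp: permutations_of_set_def)
qed

lemma average_cost_multilinear:
  assumes p: "multilinear_on n p"
  shows "multilinear_on (Suc n) (average_cost p)"
  unfolding multilinear_on_def
proof (intro allI impI)
  fix u v :: "'l list" and c a b
  assume len: "length u + length v + 1 = Suc n"
  let ?w = "\<lambda>t. u @ t # v"
  let ?t = "scale c a + b"
  let ?P = "permutations_of_set {..<Suc n}"
  have "sort_cost p (label ks (?w ?t)) [] ks
      = scale c (sort_cost p (label ks (?w a)) [] ks) + sort_cost p (label ks (?w b)) [] ks"
    if ks: "ks \<in> permutations_of_set {..<Suc n}" for ks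
  proof -
    obtain a' k b' where k: "ks = a' @ k # b'" "length a' = length u"
        "length a' + length b' + 1 = Suc n" "distinct ks"
      using permutations_split[OF ks, of "length u"] len by auto
    \<comment> \<open>The letter 0 only holds the place; \<open>label_update\<close> overwrites it
      by any letter \<open>t\<close>.\<close>
    define e where "e = label ks (?w 0)"
    have "label ks (?w t) = e(k := t)" for t
      unfolding e_def k(1) using k len by (intro label_update) auto
    with sort_cost_update[OF p, of "[]" ks k e c a b] k show ?thesis
      by (simp del: fun_upd_apply)
  qed
  then have "(\<Sum>ks\<in>?P. sort_cost p (label ks (?w ?t)) [] ks)
      = scale c (\<Sum>ks\<in>?P. sort_cost p (label ks (?w a)) [] ks)
        + (\<Sum>ks\<in>?P. sort_cost p (label ks (?w b)) [] ks)"
    by (simp only: sum.distrib scale_sum_right cong: sum.cong)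
  moreover have "length (?w t) = Suc n" for t
    using len by simp
  ultimately show "average_cost p (?w ?t) = scale c (average_cost p (?w a)) + average_cost p (?w b)"
    by (simp only: average_cost_def scale_right_distrib scale_left_commute)
qed

text \<open>Exchanging the labels at the two positions is an involution of the labellings. By
  \<open>sort_cost_transpose\<close> the word \<open>u @ x # y # v\<close> costs
  \<open>p (u @ bracket x y # v)\<close> more than \<open>u @ y # x # v\<close> under the exchanged
  labelling, and this surplus survives averaging with coefficient 1.\<close>

lemma average_cost_swap:
  assumes R: "swap_rule n p q" and p: "multilinear_on n p"
    and q: "multilinear_on (n - 1) q"
  shows "swap_rule (Suc n) (average_cost p) p"
  unfolding swap_rule_def
proof (intro allI impI)
  fix u v :: "'l list" and x y
  assume len: "length u + length v + 2 = Suc n"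
  let ?P = "permutations_of_set {..<Suc n}"
  let ?i = "length u"
  let ?\<sigma> = "\<lambda>ks :: nat list. take ?i ks @ ks ! Suc ?i # ks ! ?i # drop (Suc (Suc ?i)) ks"
  let ?C = "\<lambda>w ks. sort_cost p (label ks w) [] ks"
  have split: "\<exists>a k l b. ks = a @ k # l # b \<and> length a = ?i \<and> length b = length v \<and> distinct ks"
    if ks: "ks \<in> ?P" for ks
  proof -
    obtain a k b where k: "ks = a @ k # b" "length a = ?i" "length a + length b + 1 = Suc n" "distinct ks"
      using permutations_split[OF ks, of ?i] len by auto
    then obtain l b' where "b = l # b'" using len by (cases b) auto
    with k len show ?thesis by fastforce
  qed
  have \<sigma>: "?\<sigma> ks \<in> ?P \<and> ?\<sigma> (?\<sigma> ks) = ks" if ks: "ks \<in> ?P" for ks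
  proof -
    obtain a k l b where k: "ks = a @ k # l # b" "length a = ?i"
      using split[OF ks] by blast
    then have "?\<sigma> ks = a @ l # k # b" "?\<sigma> (a @ l # k # b) = ks"
      by (simp_all add: nth_append)
    moreover have "a @ l # k # b \<in> ?P"
      using ks k(1) by (simp only: permutations_of_set_def) auto
    ultimately show ?thesis by simp
  qed
  have C: "?C (u @ x # y # v) ks = ?C (u @ y # x # v) (?\<sigma> ks) + p (u @ bracket x y # v)"
    if ks: "ks \<in> ?P" for ks
  proof -
    obtain a k l b where k: "ks = a @ k # l # b" "length a = ?i" "length b = length v" "distinct ks"
      using split[OF ks] by blast
    define e where "e = label ks (u @ x # y # v)"
    have "map e ks = u @ x # y # v"
      unfolding e_def using k by (intro map_label) auto
    then have e: "map e a = u" "map e b = v" "e k = x" "e l = y"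
      using k(1-3) by (auto simp: append_eq_append_conv)
    have s: "?\<sigma> ks = a @ l # k # b"
      using k(1,2) by (auto simp: nth_append)
    have "e = label (?\<sigma> ks) (u @ y # x # v)"
      unfolding e_def s unfolding k(1) using k by (intro label_swap) auto
    then have "?C (u @ y # x # v) (?\<sigma> ks) = sort_cost p e [] (a @ l # k # b)"
      using s by simp
    moreover have "sort_cost p e [] (a @ k # l # b) = sort_cost p e [] (a @ l # k # b)
        + p ([] @ map e a @ bracket (e k) (e l) # map e b)"
      using k len by (intro sort_cost_transpose[OF R p q]) auto
    moreover have "?C (u @ x # y # v) ks = sort_cost p e [] (a @ k # l # b)"
      by (simp only: e_def k(1))
    ultimately show ?thesis by (simp only: e append_Nil)
  qed
  have card: "card ?P = fact (Suc n)" 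
    by (subst card_permutations_of_set) simp_all
  have nz: "(fact (Suc n) :: 'k) \<noteq> 0" by (rule fact_nonzero)
  have "(\<Sum>ks\<in>?P. ?C (u @ x # y # v) ks)
      = (\<Sum>ks\<in>?P. ?C (u @ y # x # v) (?\<sigma> ks)) + (\<Sum>ks\<in>?P. p (u @ bracket x y # v))"
    unfolding sum.distrib[symmetric] by (rule sum.cong[OF refl C])
  also have "(\<Sum>ks\<in>?P. ?C (u @ y # x # v) (?\<sigma> ks)) = (\<Sum>ks\<in>?P. ?C (u @ y # x # v) ks)"
    by (rule sum.reindex_bij_witness[of _ ?\<sigma> ?\<sigma>]) 
      (rule conjunct2[OF \<sigma>] conjunct1[OF \<sigma>] refl; assumption)+
  also have "(\<Sum>ks\<in>?P. p (u @ bracket x y # v)) = scale (fact (Suc n)) (p (u @ bracket x y # v))"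
    by (simp only: sum_constant_scale card of_nat_fact)
  finally have "(\<Sum>ks\<in>?P. ?C (u @ x # y # v) ks)
      = (\<Sum>ks\<in>?P. ?C (u @ y # x # v) ks) + scale (fact (Suc n)) (p (u @ bracket x y # v))" .
  moreover have "length (u @ s # t # v) = Suc n" for s t
    using len by simp
  moreover have "scale (1 / fact (Suc n)) (scale (fact (Suc n)) z) = z" for z
    using nz by (simp del: fact_Suc)
  ultimately show "average_cost p (u @ x # y # v)
      = average_cost p (u @ y # x # v) + p (u @ bracket x y # v)"
    by (simp only: average_cost_def scale_right_distrib)
qed

text \<open>\<open>hd\<close> evaluates words of length one, and every application of
  \<open>average_cost\<close> adds a letter; the empty word, which is the unit, goes to 0.
  Symmetrized products of two or more letters go to 0 as well, so this is the projection onto the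
  Lie algebra in the Poincare-Birkhoff-Witt decomposition.\<close>

definition lie_value :: "'l list \<Rightarrow> 'l"
  where "lie_value w = (if w = [] then 0 else (average_cost ^^ (length w - 1)) hd w)"

lemma multilinear_iterated: "multilinear_on (Suc n) ((average_cost ^^ n) hd)"
proof (induction n)
  case 0
  show ?case by (auto simp: multilinear_on_def)
next
  case (Suc n)
  then show ?case using average_cost_multilinear by simp
qed

lemma swap_rule_iterated:
  "swap_rule (Suc (Suc n)) ((average_cost ^^ Suc n) hd) ((average_cost ^^ n) hd)"
proof (induction n)
  case 0
  \<comment> \<open>Both statements are vacuous: a word of length one has no two neighbouring
    letters, and a word of length zero has no letter.\<close>
  have "swap_rule (Suc 0) hd (\<lambda>_. 0)" "multilinear_on 0 (\<lambda>_. 0)"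
    by (simp_all add: swap_rule_def multilinear_on_def)
  then show ?case
    using average_cost_swap[of "Suc 0" hd "\<lambda>_. 0"] multilinear_iterated[of 0] by simp
next
  case (Suc n)
  from average_cost_swap[OF Suc multilinear_iterated] multilinear_iterated[of n]
  show ?case by simp
qed

lemma lie_value_single [simp]: "lie_value [x] = x"
  by (simp add: lie_value_def)

lemma lie_value_linear:
  "lie_value (u @ (scale c a + b) # v) = scale c (lie_value (u @ a # v)) + lie_value (u @ b # v)"
proof -
  let ?n = "length u + length v"
  have "lie_value (u @ t # v) = (average_cost ^^ ?n) hd (u @ t # v)" for t
    by (simp add: lie_value_def)
  moreover note multilinear_onD[OF multilinear_iterated, of u v ?n c a b]
  ultimately show ?thesis by simp
qed

lemma lie_value_swap:
  "lie_value (u @ x # y # v) = lie_value (u @ y # x # v) + lie_value (u @ bracket x y # v)"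
proof -
  let ?n = "length u + length v"
  have "lie_value (u @ s # t # v) = (average_cost ^^ Suc ?n) hd (u @ s # t # v)" for s t
    by (simp add: lie_value_def)
  moreover have "lie_value (u @ t # v) = (average_cost ^^ ?n) hd (u @ t # v)" for t
    by (simp add: lie_value_def)
  moreover note swap_ruleD[OF swap_rule_iterated, of u v ?n x y]
  ultimately show ?thesis by (simp del: funpow.simps)
qed

end

section \<open>Linear maps between free vector spaces\<close>

interpretation fv: vector_space fv_scale
  by (rule vector_space_fv_scale)

abbreviation fv_linear :: "(('x \<Rightarrow>\<^sub>0 'k::field) \<Rightarrow> ('y \<Rightarrow>\<^sub>0 'k)) \<Rightarrow> bool"
  where "fv_linear \<equiv> Vector_Spaces.linear fv_scale fv_scale"

text \<open>Rules are stated for compositions \<open>F (G x)\<close> where possible, so that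
  \<open>intro fv_linear\<close> peels operations off one at a time.\<close>

named_theorems fv_linear

lemma fv_linear_iff: "fv_linear F \<longleftrightarrow>
    (\<forall>x y. F (x + y) = F x + F y) \<and> (\<forall>c x. F (fv_scale c x) = fv_scale c (F x))"
  by (simp add: Vector_Spaces.linear_iff vector_space_fv_scale)

lemma fv_linear_add: "fv_linear F \<Longrightarrow> F (x + y) = F x + F y"
  by (simp add: fv_linear_iff)

lemma fv_linear_scale: "fv_linear F \<Longrightarrow> F (fv_scale c x) = fv_scale c (F x)"
  by (simp add: fv_linear_iff)

lemma fv_linear_zero: "fv_linear F \<Longrightarrow> F 0 = 0"
  using fv_linear_scale[of F 0 0] by simp

lemma fv_linear_minus: "fv_linear F \<Longrightarrow> F (- x) = - F x"
  using fv_linear_scale[of F "-1" x] by simp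

lemma fv_linear_diff: "fv_linear F \<Longrightarrow> F (x - y) = F x - F y"
  using fv_linear_add[of F x "- y"] fv_linear_minus[of F y] by simp

lemma fv_linear_ident [fv_linear]: "fv_linear (\<lambda>x. x)"
  by (simp add: fv_linear_iff)

lemma fv_linear_const0 [fv_linear]: "fv_linear (\<lambda>x. 0)"
  by (simp add: fv_linear_iff)

lemma fv_linear_comp: "fv_linear F \<Longrightarrow> fv_linear G \<Longrightarrow> fv_linear (\<lambda>x. F (G x))"
  by (simp add: fv_linear_iff)

lemma fv_linear_plus [fv_linear]: "fv_linear F \<Longrightarrow> fv_linear G \<Longrightarrow> fv_linear (\<lambda>x. F x + G x)"
  by (simp add: fv_linear_iff algebra_simps)

lemma fv_linear_sub [fv_linear]: "fv_linear F \<Longrightarrow> fv_linear G \<Longrightarrow> fv_linear (\<lambda>x. F x - G x)"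
  by (simp add: fv_linear_iff algebra_simps)

lemma fv_linear_uminus [fv_linear]: "fv_linear F \<Longrightarrow> fv_linear (\<lambda>x. - F x)"
  by (simp add: fv_linear_iff algebra_simps)

lemma fv_linear_scaled [fv_linear]: "fv_linear F \<Longrightarrow> fv_linear (\<lambda>x. fv_scale c (F x))"
  by (simp add: fv_linear_iff fv.scale_right_distrib fv.scale_left_commute)

section \<open>Linear extension from the basis\<close>

lemma fv_extend_superset:
  assumes "finite S" "Poly_Mapping.keys p \<subseteq> S"
  shows "fv_extend h p = (\<Sum>x\<in>S. fv_scale (Poly_Mapping.lookup p x) (h x))"
  unfolding fv_extend_def using assms
  by (intro sum.mono_neutral_left) (auto simp: in_keys_iff)

lemma fv_extend_add: "fv_extend h (p + q) = fv_extend h p + fv_extend h q"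
proof -
  let ?S = "Poly_Mapping.keys p \<union> Poly_Mapping.keys q"
  have "fv_extend h r = (\<Sum>x\<in>?S. fv_scale (Poly_Mapping.lookup r x) (h x))"
    if "Poly_Mapping.keys r \<subseteq> ?S" for r
    using that by (intro fv_extend_superset) auto
  then show ?thesis
    using Poly_Mapping.keys_add[of p q]
    by (simp add: lookup_add fv.scale_left_distrib sum.distrib)
qed

lemma fv_extend_scale: "fv_extend h (fv_scale c p) = fv_scale c (fv_extend h p)"
proof -
  have "Poly_Mapping.keys (fv_scale c p) \<subseteq> Poly_Mapping.keys p"
    by (auto simp: in_keys_iff)
  then have "fv_extend h (fv_scale c p)
      = (\<Sum>x\<in>Poly_Mapping.keys p. fv_scale (Poly_Mapping.lookup (fv_scale c p) x) (h x))"
    by (intro fv_extend_superset) auto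
  then show ?thesis
    by (simp add: fv_extend_def fv.scale_sum_right)
qed

lemma fv_linear_extend: "fv_linear (fv_extend h)"
  by (simp add: fv_linear_iff fv_extend_add fv_extend_scale)

lemma fv_linear_map: "fv_linear (fv_map h)"
  unfolding fv_map_def by (rule fv_linear_extend)

lemmas fv_linear_extend_comp [fv_linear] = fv_linear_comp[OF fv_linear_extend]
lemmas fv_linear_map_comp [fv_linear] = fv_linear_comp[OF fv_linear_map]

lemma fv_extend_single [simp]: "fv_extend h (Poly_Mapping.single x 1) = h x"
  by (simp add: fv_extend_def)

lemma fv_map_single [simp]: "fv_map h (Poly_Mapping.single x 1) = Poly_Mapping.single (h x) 1"
  by (simp add: fv_map_def)

text \<open>Linearity in the values prescribed on the basis; it gives linearity of a bilinear
  extension in its second argument.\<close>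

lemma fv_linear_extend_fun [fv_linear]:
  assumes "\<And>x. fv_linear (\<lambda>p. h p x)"
  shows "fv_linear (\<lambda>p. fv_extend (h p) q)"
  using assms
  by (simp add: fv_linear_iff fv_extend_def fv.scale_sum_right fv.scale_right_distrib sum.distrib
      mult.commute)

lemma fv_linear_induct:
  assumes F: "fv_linear F" and N: "fv.subspace N"
    and single: "\<And>x. F (Poly_Mapping.single x 1) \<in> N"
  shows "F p \<in> N"
proof -
  have "p = (\<Sum>x\<in>Poly_Mapping.keys p. fv_scale (Poly_Mapping.lookup p x) (Poly_Mapping.single x 1))"
    by (rule poly_mapping_eqI)
      (simp add: lookup_sum lookup_single when_def in_keys_iff if_distrib cong: if_cong)
  also have "\<dots> \<in> {p. F p \<in> N}"
    using N single F
    by (intro fv.subspace_sum fv.subspace_scale)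
      (auto simp: fv.subspace_def fv_linear_add fv_linear_scale fv_linear_zero)
  finally show ?thesis by simp
qed

text \<open>Reduces identities between tensors to pure tensors, one argument at a time.\<close>

lemma fv_linear_eqI:
  assumes "fv_linear F" "fv_linear G"
    and "\<And>x. F (Poly_Mapping.single x 1) = G (Poly_Mapping.single x 1)"
  shows "F p = G p"
  using fv_linear_induct[of "\<lambda>x. F x - G x" "{0}" p] assms
  by (simp add: fv_linear_sub fv.subspace_def)

lemma fv_linear_eqI2:
  assumes "fv_linear F" "fv_linear G"
    and "\<And>a b. F (Poly_Mapping.single (a, b) 1) = G (Poly_Mapping.single (a, b) 1)"
  shows "F p = G p"
  by (rule fv_linear_eqI[OF assms(1,2)]) (metis assms(3) surj_pair)

lemma fv_linear_eqI3:
  assumes "fv_linear F" "fv_linear G"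
    and "\<And>a b c. F (Poly_Mapping.single (a, b, c) 1) = G (Poly_Mapping.single (a, b, c) 1)"
  shows "F p = G p"
  by (rule fv_linear_eqI[OF assms(1,2)]) (metis assms(3) surj_pair)

lemma fv_map_fv_map: "fv_map g (fv_map h p) = fv_map (\<lambda>x. g (h x)) p"
  by (rule fv_linear_eqI[where p = p]) (intro fv_linear | simp)+

section \<open>Congruence modulo a subspace\<close>

definition proj :: "('x \<Rightarrow>\<^sub>0 'k::field) set \<Rightarrow> ('x \<Rightarrow>\<^sub>0 'k) \<Rightarrow> ('x \<Rightarrow>\<^sub>0 'k)"
  where "proj N = (SOME P. fv_linear P \<and> (\<forall>x. P x = 0 \<longleftrightarrow> x \<in> N))"

text \<open>For a linear projection \<open>g\<close> onto \<open>N\<close>, the map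
  \<open>x - g x\<close> vanishes exactly on \<open>N\<close>: if x = g x, then x lies in the range
  of \<open>g\<close>.\<close>

lemma proj_exists:
  fixes N :: "('x \<Rightarrow>\<^sub>0 'k::field) set"
  assumes "fv.subspace N"
  shows "\<exists>P :: ('x \<Rightarrow>\<^sub>0 'k) \<Rightarrow> ('x \<Rightarrow>\<^sub>0 'k). fv_linear P \<and> (\<forall>x. P x = 0 \<longleftrightarrow> x \<in> N)"
proof -
  interpret vector_space_pair "fv_scale :: 'k \<Rightarrow> ('x \<Rightarrow>\<^sub>0 'k) \<Rightarrow> _" "fv_scale :: 'k \<Rightarrow> ('x \<Rightarrow>\<^sub>0 'k) \<Rightarrow> _" ..
  have "fv_linear (\<lambda>x :: 'x \<Rightarrow>\<^sub>0 'k. x)" by (rule fv_linear_ident)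
  from linear_exists_left_inverse_on[OF this assms] obtain g where
    g: "range g \<subseteq> N" "fv_linear g" "\<forall>v\<in>N. g v = v" by (auto simp: inj_on_def)
  from g have "fv_linear (\<lambda>x. x - g x)"
    by (intro fv_linear)
  moreover from g have "\<forall>x. x - g x = 0 \<longleftrightarrow> x \<in> N"
    by auto
  ultimately show ?thesis by blast
qed

lemma assumes "fv.subspace N"
  shows fv_linear_proj: "fv_linear (proj N)"
    and proj_eq_0_iff: "proj N x = 0 \<longleftrightarrow> x \<in> N"
  using someI_ex[OF proj_exists[OF assms]] unfolding proj_def by auto

lemma eq_mod_iff_proj: "fv.subspace N \<Longrightarrow> eq_mod N x y \<longleftrightarrow> proj N x = proj N y"
  by (simp add: eq_mod_def fv_linear_diff[OF fv_linear_proj] flip: proj_eq_0_iff)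

section \<open>Tensor squares and cubes\<close>

text \<open>Linearity in one tensor factor on the quotient by \<open>N\<close>; by
  \<open>slot_rels_vanish\<close> it says that a linear map kills the relations of that
  factor.\<close>

definition slot_linear :: "('k::field \<Rightarrow> 'a::ab_group_add \<Rightarrow> 'a) \<Rightarrow> 'a set \<Rightarrow> ('a \<Rightarrow> ('y \<Rightarrow>\<^sub>0 'k)) \<Rightarrow> bool"
  where "slot_linear s N h \<longleftrightarrow> (\<forall>a b. h (a + b) = h a + h b) \<and>
    (\<forall>c a. h (s c a) = fv_scale c (h a)) \<and> (\<forall>a\<in>N. h a = 0)"

lemma slot_rels_vanish:
  assumes F: "fv_linear F"
  shows "(\<forall>x\<in>slot_rels s N i. F x = 0) \<longleftrightarrow> slot_linear s N (\<lambda>a. F (Poly_Mapping.single (i a) 1))"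
proof -
  let ?e = "\<lambda>a. Poly_Mapping.single (i a) 1"
  have "F (?e (a + b) - ?e a - ?e b) = 0 \<longleftrightarrow> F (?e (a + b)) = F (?e a) + F (?e b)" for a b
    by (simp add: fv_linear_diff[OF F] diff_diff_eq fv_linear_add[OF F])
  moreover have "F (?e (s c a) - fv_scale c (?e a)) = 0 \<longleftrightarrow> F (?e (s c a)) = fv_scale c (F (?e a))" for c a
    by (simp add: fv_linear_diff[OF F] fv_linear_scale[OF F])
  moreover have "(\<forall>x\<in>slot_rels s N i. F x = 0) \<longleftrightarrow> (\<forall>a b. F (?e (a + b) - ?e a - ?e b) = 0)
    \<and> (\<forall>c a. F (?e (s c a) - fv_scale c (?e a)) = 0) \<and> (\<forall>a\<in>N. F (?e a) = 0)"
    unfolding slot_rels_def by blast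
  ultimately show ?thesis
    unfolding slot_linear_def by simp
qed

lemma slot_linearI:
  assumes "\<And>a b. h (a + b) = h a + h b" "\<And>c a. h (s c a) = fv_scale c (h a)" "\<And>a. a \<in> N \<Longrightarrow> h a = 0"
  shows "slot_linear s N h"
  using assms by (simp add: slot_linear_def)

lemma slot_linear_zero: "slot_linear s N h \<Longrightarrow> h 0 = 0"
  unfolding slot_linear_def by (metis add_cancel_left_left)

lemma slot_linear_add: "slot_linear s N h \<Longrightarrow> h (a + b) = h a + h b"
  unfolding slot_linear_def by blast

lemma slot_linear_minus: "slot_linear s N h \<Longrightarrow> h (- a) = - h a"
  using slot_linear_add[of s N h a "- a"] slot_linear_zero[of s N h] by (simp add: eq_neg_iff_add_eq_0 add.commute)

lemma slot_linear_diff: "slot_linear s N h \<Longrightarrow> h (a - b) = h a - h b"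
  using slot_linear_add[of s N h a "- b"] slot_linear_minus[of s N h b] by simp

lemma slot_linear_scale: "slot_linear s N h \<Longrightarrow> h (s c a) = fv_scale c (h a)"
  unfolding slot_linear_def by blast

lemma slot_linear_null: "slot_linear s N h \<Longrightarrow> a \<in> N \<Longrightarrow> h a = 0"
  unfolding slot_linear_def by blast

lemmas slot_linear_rules = slot_linear_zero slot_linear_add slot_linear_minus slot_linear_diff
  slot_linear_scale slot_linear_null

lemma fv_linear_vanish_span:
  assumes "fv_linear F" "p \<in> fv_span R" "\<forall>x\<in>R. F x = 0"
  shows "F p = 0"
proof -
  have "fv.subspace {p. F p = 0}"
    using assms(1) by (simp add: fv.subspace_def fv_linear_add fv_linear_scale fv_linear_zero)
  then have "fv_span R \<subseteq> {p. F p = 0}"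
    using assms(3) by (intro fv.span_minimal) auto
  then show ?thesis using assms(2) by auto
qed

text \<open>Applying a projection with kernel \<open>N\<close> turns congruence modulo \<open>N\<close> into equality, which allows
  calculations by rewriting. The values \<open>tens2 s N a b\<close> are honestly bilinear in \<open>a\<close> and \<open>b\<close>.\<close>

definition P2 :: "('k::field \<Rightarrow> 'a::ab_group_add \<Rightarrow> 'a) \<Rightarrow> 'a set \<Rightarrow> ('a \<times> 'a \<Rightarrow>\<^sub>0 'k) \<Rightarrow> ('a \<times> 'a \<Rightarrow>\<^sub>0 'k)"
  where "P2 s N = proj (tensor2_null s N)"

definition P3 :: "('k::field \<Rightarrow> 'a::ab_group_add \<Rightarrow> 'a) \<Rightarrow> 'a set \<Rightarrow> ('a \<times> 'a \<times> 'a \<Rightarrow>\<^sub>0 'k) \<Rightarrow> ('a \<times> 'a \<times> 'a \<Rightarrow>\<^sub>0 'k)"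
  where "P3 s N = proj (tensor3_null s N)"

definition tens2 :: "('k::field \<Rightarrow> 'a::ab_group_add \<Rightarrow> 'a) \<Rightarrow> 'a set \<Rightarrow> 'a \<Rightarrow> 'a \<Rightarrow> ('a \<times> 'a \<Rightarrow>\<^sub>0 'k)"
  where "tens2 s N a b = P2 s N (Poly_Mapping.single (a, b) 1)"

definition tens3 :: "('k::field \<Rightarrow> 'a::ab_group_add \<Rightarrow> 'a) \<Rightarrow> 'a set \<Rightarrow> 'a \<Rightarrow> 'a \<Rightarrow> 'a \<Rightarrow> ('a \<times> 'a \<times> 'a \<Rightarrow>\<^sub>0 'k)"
  where "tens3 s N a b c = P3 s N (Poly_Mapping.single (a, b, c) 1)"

lemma subspace_tensor2_null: "fv.subspace (tensor2_null s N)"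
  by (simp add: tensor2_null_def)

lemma subspace_tensor3_null: "fv.subspace (tensor3_null s N)"
  by (simp add: tensor3_null_def)

lemma eq_mod_tensor2: "eq_mod (tensor2_null s N) p q \<longleftrightarrow> P2 s N p = P2 s N q"
  unfolding P2_def by (rule eq_mod_iff_proj[OF subspace_tensor2_null])

lemma eq_mod_tensor3: "eq_mod (tensor3_null s N) p q \<longleftrightarrow> P3 s N p = P3 s N q"
  unfolding P3_def by (rule eq_mod_iff_proj[OF subspace_tensor3_null])

lemma fv_linear_P2: "fv_linear (P2 s N)"
  unfolding P2_def by (rule fv_linear_proj[OF subspace_tensor2_null])

lemma fv_linear_P3: "fv_linear (P3 s N)"
  unfolding P3_def by (rule fv_linear_proj[OF subspace_tensor3_null])

lemmas fv_linear_P2_comp [fv_linear] = fv_linear_comp[OF fv_linear_P2]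
lemmas fv_linear_P3_comp [fv_linear] = fv_linear_comp[OF fv_linear_P3]

lemmas P2_simps = fv_linear_add[OF fv_linear_P2] fv_linear_diff[OF fv_linear_P2]
  fv_linear_minus[OF fv_linear_P2] fv_linear_zero[OF fv_linear_P2] fv_linear_scale[OF fv_linear_P2]
  tens2_def[symmetric]

lemmas P3_simps = fv_linear_add[OF fv_linear_P3] fv_linear_diff[OF fv_linear_P3]
  fv_linear_minus[OF fv_linear_P3] fv_linear_zero[OF fv_linear_P3] fv_linear_scale[OF fv_linear_P3]
  tens3_def[symmetric]

lemma slot_linear_tens2_left: "slot_linear s N (\<lambda>a. tens2 s N a b)"
proof -
  have "slot_rels s N (\<lambda>a. (a, b)) \<subseteq> tensor2_null s N"
    unfolding tensor2_null_def by (rule order_trans[OF _ fv.span_superset]) blast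
  then have "\<forall>x\<in>slot_rels s N (\<lambda>a. (a, b)). P2 s N x = 0"
    unfolding P2_def using proj_eq_0_iff[OF subspace_tensor2_null] by blast
  then show ?thesis
    unfolding slot_rels_vanish[OF fv_linear_P2] tens2_def .
qed

lemma slot_linear_tens2_right: "slot_linear s N (\<lambda>a. tens2 s N b a)"
proof -
  have "slot_rels s N (\<lambda>a. (b, a)) \<subseteq> tensor2_null s N"
    unfolding tensor2_null_def by (rule order_trans[OF _ fv.span_superset]) blast
  then have "\<forall>x\<in>slot_rels s N (\<lambda>a. (b, a)). P2 s N x = 0"
    unfolding P2_def using proj_eq_0_iff[OF subspace_tensor2_null] by blast
  then show ?thesis
    unfolding slot_rels_vanish[OF fv_linear_P2] tens2_def .
qed

lemma slot_linear_tens3: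
  "slot_linear s N (\<lambda>a. tens3 s N a b c)" (is ?A)
  "slot_linear s N (\<lambda>a. tens3 s N b a c)" (is ?B)
  "slot_linear s N (\<lambda>a. tens3 s N b c a)" (is ?C)
proof -
  have "slot_rels s N (\<lambda>a. (a, b, c)) \<union> slot_rels s N (\<lambda>a. (b, a, c)) \<union> slot_rels s N (\<lambda>a. (b, c, a))
      \<subseteq> tensor3_null s N"
    unfolding tensor3_null_def by (rule order_trans[OF _ fv.span_superset]) blast
  then have "\<forall>x\<in>slot_rels s N (\<lambda>a. (a, b, c)). P3 s N x = 0"
    "\<forall>x\<in>slot_rels s N (\<lambda>a. (b, a, c)). P3 s N x = 0"
    "\<forall>x\<in>slot_rels s N (\<lambda>a. (b, c, a)). P3 s N x = 0"
    unfolding P3_def using proj_eq_0_iff[OF subspace_tensor3_null] by blast+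
  then show ?A ?B ?C
    unfolding slot_rels_vanish[OF fv_linear_P3] tens3_def .
qed

lemmas tens2_simps = slot_linear_rules[OF slot_linear_tens2_left] slot_linear_rules[OF slot_linear_tens2_right]
lemmas tens3_simps = slot_linear_rules[OF slot_linear_tens3(1)] slot_linear_rules[OF slot_linear_tens3(2)]
  slot_linear_rules[OF slot_linear_tens3(3)]

text \<open>The universal property of the tensor square: such a map kills the generators of
  \<open>tensor2_null\<close>, hence their span.\<close>

lemma tensor2_lift:
  assumes F: "fv_linear F"
    and 1: "\<And>b. slot_linear s N (\<lambda>a. F (Poly_Mapping.single (a, b) 1))"
    and 2: "\<And>b. slot_linear s N (\<lambda>a. F (Poly_Mapping.single (b, a) 1))"
    and eq: "P2 s N p = P2 s N q"
  shows "F p = F q"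
proof -
  have "p - q \<in> tensor2_null s N"
    using eq by (simp add: eq_mod_def flip: eq_mod_tensor2)
  moreover have "\<forall>x \<in> (\<Union>b. slot_rels s N (\<lambda>a. (a, b)) \<union> slot_rels s N (\<lambda>a. (b, a))). F x = 0"
    using 1 2 by (simp only: ball_UN ball_Un slot_rels_vanish[OF F]) simp
  ultimately have "F (p - q) = 0"
    unfolding tensor2_null_def by (rule fv_linear_vanish_span[OF F])
  then show ?thesis by (simp add: fv_linear_diff[OF F])
qed

lemma tensor3_lift:
  assumes F: "fv_linear F"
    and 1: "\<And>b c. slot_linear s N (\<lambda>a. F (Poly_Mapping.single (a, b, c) 1))"
    and 2: "\<And>b c. slot_linear s N (\<lambda>a. F (Poly_Mapping.single (b, a, c) 1))"
    and 3: "\<And>b c. slot_linear s N (\<lambda>a. F (Poly_Mapping.single (b, c, a) 1))"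
    and eq: "P3 s N p = P3 s N q"
  shows "F p = F q"
proof -
  have "p - q \<in> tensor3_null s N"
    using eq by (simp add: eq_mod_def flip: eq_mod_tensor3)
  moreover have "\<forall>x \<in> (\<Union>b c. slot_rels s N (\<lambda>a. (a, b, c)) \<union> slot_rels s N (\<lambda>a. (b, a, c))
      \<union> slot_rels s N (\<lambda>a. (b, c, a))). F x = 0"
    using 1 2 3 by (simp only: ball_UN ball_Un slot_rels_vanish[OF F]) simp
  ultimately have "F (p - q) = 0"
    unfolding tensor3_null_def by (rule fv_linear_vanish_span[OF F])
  then show ?thesis by (simp add: fv_linear_diff[OF F])
qed

section \<open>Enveloping algebras\<close>

lemma fv_mult_single [simp]:
  "fv_mult op (Poly_Mapping.single x 1) (Poly_Mapping.single y 1) = Poly_Mapping.single (op x y) 1"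
  by (simp add: fv_mult_def)

lemma fv_linear_mult_left: "fv_linear (\<lambda>p. fv_mult op p q)"
  unfolding fv_mult_def by (rule fv_linear_extend)

lemma fv_linear_mult_right: "fv_linear (fv_mult op p)"
  unfolding fv_mult_def by (intro fv_linear)

lemmas fv_linear_mult_left_comp [fv_linear] = fv_linear_comp[OF fv_linear_mult_left]
lemmas fv_linear_mult_right_comp [fv_linear] = fv_linear_comp[OF fv_linear_mult_right]

lemma fa_mult_single [simp]:
  "fa_mult (Poly_Mapping.single u 1) (Poly_Mapping.single v 1) = Poly_Mapping.single (u @ v) 1"
  by (simp add: fa_mult_def)

lemma fv_linear_fa_mult [fv_linear]:
  "fv_linear F \<Longrightarrow> fv_linear (\<lambda>p. fa_mult (F p) q)"
  "fv_linear F \<Longrightarrow> fv_linear (\<lambda>p. fa_mult q (F p))"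
  unfolding fa_mult_def by (intro fv_linear; assumption)+

lemma fa_mult_one [simp]: "fa_mult fa_one p = p" "fa_mult p fa_one = p"
  by (rule fv_linear_eqI[where p = p]; (intro fv_linear | simp add: fa_one_def))+

lemma fv_linear_mult2 [fv_linear]:
  "fv_linear F \<Longrightarrow> fv_linear (\<lambda>p. mult2 (F p) q)"
  "fv_linear F \<Longrightarrow> fv_linear (\<lambda>p. mult2 q (F p))"
  unfolding mult2_def by (intro fv_linear; assumption)+

lemma fv_linear_mult3 [fv_linear]:
  "fv_linear F \<Longrightarrow> fv_linear (\<lambda>p. mult3 (F p) q)"
  "fv_linear F \<Longrightarrow> fv_linear (\<lambda>p. mult3 q (F p))"
  unfolding mult3_def by (intro fv_linear; assumption)+

lemma fv_linear_comm2 [fv_linear]: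
  "fv_linear F \<Longrightarrow> fv_linear (\<lambda>p. comm2 (F p) q)"
  "fv_linear F \<Longrightarrow> fv_linear (\<lambda>p. comm2 q (F p))"
  unfolding comm2_def by (intro fv_linear; assumption)+

lemma fv_linear_comm3 [fv_linear]:
  "fv_linear F \<Longrightarrow> fv_linear (\<lambda>p. comm3 (F p) q)"
  "fv_linear F \<Longrightarrow> fv_linear (\<lambda>p. comm3 q (F p))"
  unfolding comm3_def by (intro fv_linear; assumption)+

lemma mult2_single [simp]:
  "mult2 (Poly_Mapping.single (a, b) 1) (Poly_Mapping.single (a', b') 1)
    = Poly_Mapping.single (fa_mult a a', fa_mult b b') 1"
  by (simp add: mult2_def)

lemma mult3_single [simp]:
  "mult3 (Poly_Mapping.single (a, b, c) 1) (Poly_Mapping.single (a', b', c') 1)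
    = Poly_Mapping.single (fa_mult a a', fa_mult b b', fa_mult c c') 1"
  by (simp add: mult3_def)

lemma mult2_add_left: "mult2 (p + q) t = mult2 p t + mult2 q t"
  by (rule fv_linear_add) (intro fv_linear)

lemma mult2_add_right: "mult2 t (p + q) = mult2 t p + mult2 t q"
  by (rule fv_linear_add) (intro fv_linear)

lemma comult_gen: "comult (fa_gen x)
    = Poly_Mapping.single (fa_gen x, fa_one) 1 + Poly_Mapping.single (fa_one, fa_gen x) 1"
  by (simp add: comult_def fa_gen_def[of x] mult2_add_left)

lemma fv_linear_incl2 [fv_linear]: "fv_linear F \<Longrightarrow> fv_linear (\<lambda>p. incl2 (F p))"
  unfolding incl2_def by (intro fv_linear)

lemma fv_linear_legs [fv_linear]:
  "fv_linear F \<Longrightarrow> fv_linear (\<lambda>p. leg12 (F p))"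
  "fv_linear F \<Longrightarrow> fv_linear (\<lambda>p. leg13 (F p))"
  "fv_linear F \<Longrightarrow> fv_linear (\<lambda>p. leg23 (F p))"
  unfolding leg12_def leg13_def leg23_def by (intro fv_linear; assumption)+

definition incl3 :: "('l \<times> 'l \<times> 'l \<Rightarrow>\<^sub>0 'k::field)
    \<Rightarrow> (('l, 'k) free_alg \<times> ('l, 'k) free_alg \<times> ('l, 'k) free_alg \<Rightarrow>\<^sub>0 'k)"
  where "incl3 = fv_map (\<lambda>(a, b, c). (fa_gen a, fa_gen b, fa_gen c))"

lemma fv_linear_incl3 [fv_linear]: "fv_linear F \<Longrightarrow> fv_linear (\<lambda>p. incl3 (F p))"
  unfolding incl3_def by (intro fv_linear)

lemma incl_single [simp]:
  "incl2 (Poly_Mapping.single (a, b) 1) = Poly_Mapping.single (fa_gen a, fa_gen b) 1"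
  "incl3 (Poly_Mapping.single (a, b, c) 1) = Poly_Mapping.single (fa_gen a, fa_gen b, fa_gen c) 1"
  "leg12 (Poly_Mapping.single (a, b) 1) = Poly_Mapping.single (fa_gen a, fa_gen b, fa_one) 1"
  "leg13 (Poly_Mapping.single (a, b) 1) = Poly_Mapping.single (fa_gen a, fa_one, fa_gen b) 1"
  "leg23 (Poly_Mapping.single (a, b) 1) = Poly_Mapping.single (fa_one, fa_gen a, fa_gen b) 1"
  by (simp_all add: incl2_def incl3_def leg12_def leg13_def leg23_def)

lemma incl_add:
  "incl2 (p + q) = incl2 p + incl2 q"
  "incl3 (t + u) = incl3 t + incl3 u"
  by (rule fv_linear_add; intro fv_linear)+

section \<open>Linear maps out of the enveloping algebra\<close>

lemma U_rels_null: "g \<in> U_rels s br \<Longrightarrow> g \<in> U_null s br"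
  unfolding U_null_def
  by (rule fv.span_base) (rule CollectI, rule exI[of _ fa_one], rule exI[of _ g], rule exI[of _ fa_one], simp)

lemma slot_linear_gen:
  assumes "slot_linear fv_scale (U_null s br) h"
  shows "slot_linear s {} (\<lambda>x. h (fa_gen x))"
proof (rule slot_linearI)
  note U_rels_null[of _ s br, THEN slot_linear_null[OF assms]]
  then have N: "h g = 0" if "g \<in> slot_rels s {} (\<lambda>x. [x])" for g
    using that by (simp add: U_rels_def)
  have "h (fa_gen (a + b) - fa_gen a - fa_gen b) = 0" for a b
    by (rule N) (auto simp: slot_rels_def fa_gen_def)
  then show "h (fa_gen (a + b)) = h (fa_gen a) + h (fa_gen b)" for a b
    by (simp add: slot_linear_diff[OF assms] slot_linear_add[OF assms] algebra_simps diff_eq_eq)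
  have "h (fa_gen (s c a) - fv_scale c (fa_gen a)) = 0" for c a
    by (rule N) (auto simp: slot_rels_def fa_gen_def)
  then show "h (fa_gen (s c a)) = fv_scale c (h (fa_gen a))" for c a
    by (simp add: slot_linear_diff[OF assms] slot_linear_scale[OF assms])
qed simp

lemma slot_linear_commutator:
  assumes "slot_linear fv_scale (U_null s br) h"
  shows "h (fa_mult (fa_gen x) (fa_gen y)) = h (fa_mult (fa_gen y) (fa_gen x)) + h (fa_gen (br x y))"
proof -
  have "h (fa_mult (fa_gen x) (fa_gen y) - fa_mult (fa_gen y) (fa_gen x) - fa_gen (br x y)) = 0"
    by (rule slot_linear_null[OF assms], rule U_rels_null) (auto simp: U_rels_def)
  then show ?thesis
    by (simp add: slot_linear_diff[OF assms] slot_linear_add[OF assms] algebra_simps diff_eq_eq)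
qed

text \<open>Lets a linear variable sit inside an extension over another tensor factor, as in the
  iterated extensions that tensor copies of the retraction.\<close>

lemma slot_linear_pointwise:
  assumes "\<And>w. slot_linear s N (\<lambda>a. h a w)"
  shows "slot_linear s N (\<lambda>a. fv_extend (h a) u)"
  using assms
  by (simp add: slot_linear_def fv_extend_def fv.scale_sum_right fv.scale_right_distrib sum.distrib
      mult.commute)

text \<open>The element of \<ll> \<otimes> \<ll> that represents \<open>\<delta>\<^sub>t(x)\<close>.
  As \<open>x\<close> stands on the right in both brackets, it is minus the adjoint action of
  \<open>x\<close> on \<open>t\<close>.\<close>

definition ad2 :: "('l \<Rightarrow> 'l \<Rightarrow> 'l) \<Rightarrow> ('l \<times> 'l \<Rightarrow>\<^sub>0 'k::field) \<Rightarrow> 'l \<Rightarrow> ('l \<times> 'l \<Rightarrow>\<^sub>0 'k)"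
  where "ad2 br t x
    = fv_extend (\<lambda>(a, b). Poly_Mapping.single (br a x, b) 1 + Poly_Mapping.single (a, br b x) 1) t"

text \<open>The polarized left-hand side of the classical Yang--Baxter equation in \<open>\<ll> \<otimes> \<ll> \<otimes> \<ll>\<close>.\<close>

definition cyb :: "('l \<Rightarrow> 'l \<Rightarrow> 'l) \<Rightarrow> ('l \<times> 'l \<Rightarrow>\<^sub>0 'k::field) \<Rightarrow> ('l \<times> 'l \<Rightarrow>\<^sub>0 'k) \<Rightarrow> ('l \<times> 'l \<times> 'l \<Rightarrow>\<^sub>0 'k)"
  where "cyb br t t' = fv_extend (\<lambda>(a, b). fv_extend (\<lambda>(c, d). Poly_Mapping.single (br a c, b, d) 1
    + Poly_Mapping.single (a, br b c, d) 1 + Poly_Mapping.single (a, c, br b d) 1) t') t"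

lemma fv_linear_ad2 [fv_linear]: "fv_linear F \<Longrightarrow> fv_linear (\<lambda>p. ad2 br (F p) x)"
  unfolding ad2_def by (intro fv_linear)

lemma ad2_single [simp]: "ad2 br (Poly_Mapping.single (a, b) 1) x
    = Poly_Mapping.single (br a x, b) 1 + Poly_Mapping.single (a, br b x) 1"
  by (simp add: ad2_def)

lemma fv_linear_cyb [fv_linear]:
  "fv_linear F \<Longrightarrow> fv_linear (\<lambda>p. cyb br (F p) t)"
  "fv_linear F \<Longrightarrow> fv_linear (\<lambda>p. cyb br t (F p))"
  unfolding cyb_def by (intro fv_linear; auto intro!: fv_linear split: prod.split)+

lemma cyb_single [simp]: "cyb br (Poly_Mapping.single (a, b) 1) (Poly_Mapping.single (c, d) 1)
    = Poly_Mapping.single (br a c, b, d) 1 + Poly_Mapping.single (a, br b c, d) 1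
      + Poly_Mapping.single (a, c, br b d) 1"
  by (simp add: cyb_def)

text \<open>The factor 1 commutes with everything, so the commutator of a pure tensor with x
  \<otimes> 1 + 1 \<otimes> x leaves one bracket in each factor in turn.\<close>

lemma delta_eq_ad2:
  "P2 fv_scale (U_null s br) (delta t x) = P2 fv_scale (U_null s br) (incl2 (ad2 br t x))"
  unfolding delta_def
proof (rule fv_linear_eqI2[where p = t])
  fix a b
  note c1 = slot_linear_commutator[OF slot_linear_tens2_left, of s br]
  note c2 = slot_linear_commutator[OF slot_linear_tens2_right, of s br]
  show "P2 fv_scale (U_null s br) (comm2 (incl2 (Poly_Mapping.single (a, b) 1)) (comult (fa_gen x)))
      = P2 fv_scale (U_null s br) (incl2 (ad2 br (Poly_Mapping.single (a, b) 1) x))"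
    \<comment> \<open>Commutation is used for the given letters only: the general rule would
      exchange two letters back and forth.\<close>
    by (simp add: comult_gen comm2_def mult2_add_left mult2_add_right incl_add P2_simps
        c1[where x = a and y = x] c2[where x = b and y = x] algebra_simps)
qed (intro fv_linear)+

text \<open>The two legs in each commutator share a single tensor factor, where the products differ
  by one bracket.\<close>

lemma cybe_eq_cyb:
  "P3 fv_scale (U_null s br) (comm3 (leg12 t) (leg13 t') + comm3 (leg12 t) (leg23 t')
      + comm3 (leg13 t) (leg23 t'))
    = P3 fv_scale (U_null s br) (incl3 (cyb br t t'))"
proof (rule fv_linear_eqI2[where p = t])
  fix a b
  show "P3 fv_scale (U_null s br) (comm3 (leg12 (Poly_Mapping.single (a, b) 1)) (leg13 t')
      + comm3 (leg12 (Poly_Mapping.single (a, b) 1)) (leg23 t')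
      + comm3 (leg13 (Poly_Mapping.single (a, b) 1)) (leg23 t'))
    = P3 fv_scale (U_null s br) (incl3 (cyb br (Poly_Mapping.single (a, b) 1) t'))"
  proof (rule fv_linear_eqI2[where p = t'])
    fix c d
    note c = slot_linear_commutator[OF slot_linear_tens3(1), of s br]
      slot_linear_commutator[OF slot_linear_tens3(2), of s br]
      slot_linear_commutator[OF slot_linear_tens3(3), of s br]
    show "P3 fv_scale (U_null s br) (comm3 (leg12 (Poly_Mapping.single (a, b) 1)) (leg13 (Poly_Mapping.single (c, d) 1))
        + comm3 (leg12 (Poly_Mapping.single (a, b) 1)) (leg23 (Poly_Mapping.single (c, d) 1))
        + comm3 (leg13 (Poly_Mapping.single (a, b) 1)) (leg23 (Poly_Mapping.single (c, d) 1)))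
      = P3 fv_scale (U_null s br)
          (incl3 (cyb br (Poly_Mapping.single (a, b) 1) (Poly_Mapping.single (c, d) 1)))"
      by (simp add: comm3_def incl_add P3_simps
        c(1)[where x = a and y = c] c(2)[where x = b and y = c] c(3)[where x = b and y = d] algebra_simps)
  qed (intro fv_linear)+
qed (intro fv_linear)+

section \<open>Injectivity of the inclusions of tensor powers\<close>

context lie_algebra
begin

lemma lie_value_add: "lie_value (u @ (a + b) # v) = lie_value (u @ a # v) + lie_value (u @ b # v)"
  using lie_value_linear[of u 1] by simp

lemma lie_value_scale: "lie_value (u @ scale c a # v) = scale c (lie_value (u @ a # v))"
proof -
  have "lie_value (u @ 0 # v) = 0"
    using lie_value_add[of u 0 0] by simp
  then show ?thesis using lie_value_linear[of u c a 0] by simp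
qed

text \<open>Inside a word the relations of \<open>U_rels\<close> are killed by linearity of
  \<open>lie_value\<close> in a letter and by \<open>lie_value_swap\<close>; linearity in both
  cofactors then covers the two-sided ideal. The map \<open>k\<close> is arbitrary so that the
  retraction can act in one tensor factor while the others are fixed.\<close>

lemma slot_linear_lie_value:
  assumes k: "slot_linear scale {} k"
  shows "slot_linear fv_scale (U_null scale bracket) (fv_extend (\<lambda>w. k (lie_value w)))"
proof (rule slot_linearI)
  let ?H = "fv_extend (\<lambda>w. k (lie_value w))"
  show "?H (a + b) = ?H a + ?H b" for a b by (rule fv_extend_add)
  show "?H (fv_scale c a) = fv_scale c (?H a)" for c a by (rule fv_extend_scale)
  have word: "?H (fa_mult (fa_mult (Poly_Mapping.single u 1) g) (Poly_Mapping.single v 1)) = 0"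
    if g: "g \<in> U_rels scale bracket" for u g v
  proof -
    define G where "G g = ?H (fa_mult (fa_mult (Poly_Mapping.single u 1) g) (Poly_Mapping.single v 1))" for g
    have G: "fv_linear G" unfolding G_def by (intro fv_linear)
    have Gw: "G (Poly_Mapping.single w 1) = k (lie_value (u @ w @ v))" for w
      by (simp add: G_def)
    have "slot_linear scale {} (\<lambda>x. G (Poly_Mapping.single [x] 1))"
      by (rule slot_linearI)
        (simp_all add: Gw lie_value_add lie_value_scale slot_linear_add[OF k] slot_linear_scale[OF k])
    then have "\<forall>x\<in>slot_rels scale {} (\<lambda>x. [x]). G x = 0"
      by (simp add: slot_rels_vanish[OF G])
    moreover have "G (fa_mult (fa_gen x) (fa_gen y) - fa_mult (fa_gen y) (fa_gen x) - fa_gen (bracket x y)) = 0" for x y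
      using lie_value_swap[of u x y v]
      by (simp add: fv_linear_diff[OF G] fa_gen_def Gw slot_linear_add[OF k])
    ultimately have "G g = 0" using g unfolding U_rels_def by auto
    then show ?thesis by (simp add: G_def)
  qed
  have "?H (fa_mult (fa_mult u g) v) = 0" if g: "g \<in> U_rels scale bracket" for u g v
  proof (rule fv_linear_eqI[where p = u])
    fix a
    show "?H (fa_mult (fa_mult (Poly_Mapping.single a 1) g) v) = 0"
      by (rule fv_linear_eqI[where p = v]) (intro fv_linear | simp add: word[OF g])+
  qed (intro fv_linear)+
  then show "?H a = 0" if "a \<in> U_null scale bracket" for a
    using that unfolding U_null_def by (intro fv_linear_vanish_span[OF fv_linear_extend]) auto
qed

lemma incl2_inject:
  "P2 fv_scale (U_null scale bracket) (incl2 p) = P2 fv_scale (U_null scale bracket) (incl2 q)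
    \<longleftrightarrow> P2 scale {} p = P2 scale {} q"
proof
  assume eq: "P2 scale {} p = P2 scale {} q"
  show "P2 fv_scale (U_null scale bracket) (incl2 p) = P2 fv_scale (U_null scale bracket) (incl2 q)"
  proof (rule tensor2_lift[OF _ _ _ eq])
    show "fv_linear (\<lambda>p. P2 fv_scale (U_null scale bracket) (incl2 p))" by (intro fv_linear)
  qed (auto simp: P2_simps intro!: slot_linear_gen slot_linear_tens2_left slot_linear_tens2_right)
next
  \<comment> \<open>The tensor square of the retraction; composed with \<open>incl2\<close> it
    returns the class of a tensor.\<close>
  let ?F = "fv_extend (\<lambda>(u, v). fv_extend (\<lambda>w. fv_extend (\<lambda>w'. tens2 scale {} (lie_value w) (lie_value w')) v) u)"
  assume eq: "P2 fv_scale (U_null scale bracket) (incl2 p) = P2 fv_scale (U_null scale bracket) (incl2 q)"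
  have "?F (incl2 p) = ?F (incl2 q)"
  proof (rule tensor2_lift[OF _ _ _ eq])
    show "fv_linear ?F" by (rule fv_linear_extend)
    show "slot_linear fv_scale (U_null scale bracket) (\<lambda>a. ?F (Poly_Mapping.single (a, b) 1))" for b
      by (simp, rule slot_linear_lie_value[where k = "\<lambda>x. fv_extend (\<lambda>w'. tens2 scale {} x (lie_value w')) b"], 
        rule slot_linear_pointwise, rule slot_linear_tens2_left)
    show "slot_linear fv_scale (U_null scale bracket) (\<lambda>a. ?F (Poly_Mapping.single (b, a) 1))" for b
      by (simp, rule slot_linear_pointwise, rule slot_linear_lie_value, rule slot_linear_tens2_right)
  qed
  moreover have "?F (incl2 t) = P2 scale {} t" for t
    by (rule fv_linear_eqI2[where p = t]) (intro fv_linear | simp add: fa_gen_def tens2_def)+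
  ultimately show "P2 scale {} p = P2 scale {} q" by simp
qed

lemma incl3_inject:
  "P3 fv_scale (U_null scale bracket) (incl3 p) = P3 fv_scale (U_null scale bracket) (incl3 q)
    \<longleftrightarrow> P3 scale {} p = P3 scale {} q"
proof
  assume eq: "P3 scale {} p = P3 scale {} q"
  show "P3 fv_scale (U_null scale bracket) (incl3 p) = P3 fv_scale (U_null scale bracket) (incl3 q)"
  proof (rule tensor3_lift[OF _ _ _ _ eq])
    show "fv_linear (\<lambda>p. P3 fv_scale (U_null scale bracket) (incl3 p))" by (intro fv_linear)
  qed (auto simp: P3_simps intro!: slot_linear_gen slot_linear_tens3)
next
  let ?t = "\<lambda>w w' w''. tens3 scale {} (lie_value w) (lie_value w') (lie_value w'')"
  let ?F = "fv_extend (\<lambda>(u, v, z). fv_extend (\<lambda>w. fv_extend (\<lambda>w'. fv_extend (\<lambda>w''. ?t w w' w'') z) v) u)"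
  assume eq: "P3 fv_scale (U_null scale bracket) (incl3 p) = P3 fv_scale (U_null scale bracket) (incl3 q)"
  have "?F (incl3 p) = ?F (incl3 q)"
  proof (rule tensor3_lift[OF _ _ _ _ eq])
    show "fv_linear ?F" by (rule fv_linear_extend)
    show "slot_linear fv_scale (U_null scale bracket) (\<lambda>a. ?F (Poly_Mapping.single (a, b, c) 1))" for b c
      by (simp, rule slot_linear_lie_value[where k = "\<lambda>x. fv_extend (\<lambda>w'.
          fv_extend (\<lambda>w''. tens3 scale {} x (lie_value w') (lie_value w'')) c) b"], 
        (rule slot_linear_pointwise)+, rule slot_linear_tens3)
    show "slot_linear fv_scale (U_null scale bracket) (\<lambda>a. ?F (Poly_Mapping.single (b, a, c) 1))" for b c
      by (simp, rule slot_linear_pointwise, rule slot_linear_lie_value[where k = "\<lambda>x. 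
          fv_extend (\<lambda>w''. tens3 scale {} (lie_value w) x (lie_value w'')) c" for w], 
        (rule slot_linear_pointwise)+, rule slot_linear_tens3)
    show "slot_linear fv_scale (U_null scale bracket) (\<lambda>a. ?F (Poly_Mapping.single (b, c, a) 1))" for b c
      by (simp, (rule slot_linear_pointwise)+, rule slot_linear_lie_value, rule slot_linear_tens3)
  qed
  moreover have "?F (incl3 t) = P3 scale {} t" for t
    by (rule fv_linear_eqI3[where p = t]) (intro fv_linear | simp add: fa_gen_def tens3_def)+
  ultimately show "P3 scale {} p = P3 scale {} q" by simp
qed

end

section \<open>Quasi-triangular Lie bialgebras without enveloping algebras\<close>

lemma tau_single [simp]:
  "tau (Poly_Mapping.single (a, b) 1) = Poly_Mapping.single (b, a) 1"
  "tau12 (Poly_Mapping.single (a, b, c) 1) = Poly_Mapping.single (b, a, c) 1"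
  "tau23 (Poly_Mapping.single (a, b, c) 1) = Poly_Mapping.single (a, c, b) 1"
  by (simp_all add: tau_def tau12_def tau23_def)

lemma fv_linear_tau [fv_linear]:
  "fv_linear F \<Longrightarrow> fv_linear (\<lambda>p. tau (F p))"
  "fv_linear F' \<Longrightarrow> fv_linear (\<lambda>p. tau12 (F' p))"
  "fv_linear F' \<Longrightarrow> fv_linear (\<lambda>p. tau23 (F' p))"
  unfolding tau_def tau12_def tau23_def by (intro fv_linear; assumption)+

lemma fv_linear_tensor_id [fv_linear]: "fv_linear F \<Longrightarrow> fv_linear (\<lambda>p. tensor_id d (F p))"
  unfolding tensor_id_def by (intro fv_linear)

lemma tensor_id_single [simp]:
  "tensor_id d (Poly_Mapping.single (a, b) 1) = fv_map (\<lambda>(a1, a2). (a1, a2, b)) (d a)"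
  by (simp add: tensor_id_def)

definition cyc :: "('a \<times> 'a \<times> 'a \<Rightarrow>\<^sub>0 'k::field) \<Rightarrow> ('a \<times> 'a \<times> 'a \<Rightarrow>\<^sub>0 'k)"
  where "cyc p = p + tau12 (tau23 p) + tau23 (tau12 p)"

lemma fv_linear_cyc [fv_linear]: "fv_linear F \<Longrightarrow> fv_linear (\<lambda>p. cyc (F p))"
  unfolding cyc_def by (intro fv_linear)

lemma cyc_single [simp]: "cyc (Poly_Mapping.single (a, b, c) 1) = Poly_Mapping.single (a, b, c) 1
    + Poly_Mapping.single (c, a, b) 1 + Poly_Mapping.single (b, c, a) 1"
  by (simp add: cyc_def)

lemma cyc_add: "cyc (p + q) = cyc p + cyc q"
  by (rule fv_linear_add) (intro fv_linear)

lemma tensor_id_add: "tensor_id d (p + q) = tensor_id d p + tensor_id d q"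
  by (rule fv_linear_add) (intro fv_linear)

lemma ad2_add: "ad2 br (p + q) x = ad2 br p x + ad2 br q x"
  by (rule fv_linear_add) (intro fv_linear)

lemma ad2_scale: "ad2 br (fv_scale c p) x = fv_scale c (ad2 br p x)"
  by (rule fv_linear_scale) (intro fv_linear)

lemma cyb_add_left: "cyb br (p + q) t = cyb br p t + cyb br q t"
  by (rule fv_linear_add) (intro fv_linear)

lemma cyb_add_right: "cyb br t (p + q) = cyb br t p + cyb br t q"
  by (rule fv_linear_add) (intro fv_linear)

lemma cyb_scale_left: "cyb br (fv_scale c p) t = fv_scale c (cyb br p t)"
  by (rule fv_linear_scale) (intro fv_linear)

lemma cyb_scale_right: "cyb br t (fv_scale c p) = fv_scale c (cyb br t p)"
  by (rule fv_linear_scale) (intro fv_linear)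

lemma fv_map_add: "fv_map h (p + q) = fv_map h p + fv_map h q"
  by (rule fv_linear_add) (intro fv_linear)

text \<open>Operations act on representatives; this and the next congruences show that they are well
  defined on tensor powers.\<close>

lemma tensor_cyc_cong:
  assumes "P3 s N p = P3 s N q"
  shows "P3 s N (cyc p) = P3 s N (cyc q)"
  by (rule tensor3_lift[OF _ _ _ _ assms])
    (intro fv_linear | rule slot_linearI | simp add: P3_simps tens3_simps algebra_simps)+

lemma tensor_tau_cong:
  assumes "P2 s N p = P2 s N q"
  shows "P2 s N (tau p) = P2 s N (tau q)"
  by (rule tensor2_lift[OF _ _ _ assms])
    (intro fv_linear | rule slot_linearI | simp add: P2_simps tens2_simps algebra_simps)+

lemma tensor_append_cong:
  assumes "P2 s N p = P2 s N q"
  shows "P3 s N (fv_map (\<lambda>(a1, a2). (a1, a2, b)) p) = P3 s N (fv_map (\<lambda>(a1, a2). (a1, a2, b)) q)"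
  by (rule tensor2_lift[OF _ _ _ assms])
    (intro fv_linear | rule slot_linearI | simp add: P3_simps tens3_simps)+

lemma linear_into_square_iff: "linear_into_square s d \<longleftrightarrow> slot_linear s {} (\<lambda>x. P2 s {} (d x))"
  by (simp add: linear_into_square_def slot_linear_def eq_mod_tensor2 P2_simps)

lemma tensor_id_cong:
  assumes d: "linear_into_square s d" and "P2 s {} p = P2 s {} q"
  shows "P3 s {} (tensor_id d p) = P3 s {} (tensor_id d q)"
proof (rule tensor2_lift[OF _ _ _ assms(2)])
  note d' = d[unfolded linear_into_square_def eq_mod_tensor2]
  let ?m = "\<lambda>b. fv_map (\<lambda>(a1, a2). (a1, a2, b))"
  show "slot_linear s {} (\<lambda>a. P3 s {} (tensor_id d (Poly_Mapping.single (a, b) 1)))" for b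
  proof (rule slot_linearI)
    fix x y c
    have "P3 s {} (?m b (d (x + y))) = P3 s {} (?m b (d x + d y))"
      using d' by (intro tensor_append_cong) blast
    then show "P3 s {} (tensor_id d (Poly_Mapping.single (x + y, b) 1))
      = P3 s {} (tensor_id d (Poly_Mapping.single (x, b) 1)) + P3 s {} (tensor_id d (Poly_Mapping.single (y, b) 1))"
      by (simp add: P3_simps fv_map_add)
    have "P3 s {} (?m b (d (s c x))) = P3 s {} (?m b (fv_scale c (d x)))"
      using d' by (intro tensor_append_cong) blast
    then show "P3 s {} (tensor_id d (Poly_Mapping.single (s c x, b) 1))
      = fv_scale c (P3 s {} (tensor_id d (Poly_Mapping.single (x, b) 1)))"
      by (simp add: P3_simps fv_linear_scale[OF fv_linear_map])
  qed simp
  show "slot_linear s {} (\<lambda>a. P3 s {} (tensor_id d (Poly_Mapping.single (b, a) 1)))" for b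
  proof -
    \<comment> \<open>Written as an extension over \<open>d b\<close>, the expression contains the
      varying factor \<open>a\<close> only in pure tensors, which are linear in it.\<close>
    have "P3 s {} (?m a (d b)) = fv_extend (\<lambda>(a1, a2). tens3 s {} a1 a2 a) (d b)" for a
      by (rule fv_linear_eqI2[where p = "d b"]) (intro fv_linear | simp add: tens3_def)+
    moreover have "slot_linear s {} (\<lambda>a. fv_extend (\<lambda>(a1, a2). tens3 s {} a1 a2 a) (d b))"
      by (rule slot_linear_pointwise) (auto intro: slot_linear_tens3)
    ultimately show ?thesis by simp
  qed
qed (intro fv_linear)

section \<open>Coboundaries and the Yang-Baxter equation over the Lie algebra\<close>

context lie_algebra
begin

lemma bracket_leibniz: "bracket (bracket a x) y = bracket (bracket a y) x + bracket a (bracket x y)"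
proof -
  have "bracket a (bracket x y) + bracket (bracket a y) x + bracket y (bracket a x) = 0"
    by (rule bracket_jacobi)
  then have "bracket a (bracket x y) + bracket (bracket a y) x = - bracket y (bracket a x)"
    by (rule eq_neg_iff_add_eq_0[THEN iffD2])
  then show ?thesis
    by (simp add: bracket_antisym[of _ y] add.commute)
qed

lemma ad2_cong:
  assumes "P2 scale {} p = P2 scale {} q"
  shows "P2 scale {} (ad2 bracket p x) = P2 scale {} (ad2 bracket q x)"
  by (rule tensor2_lift[OF _ _ _ assms])
    (intro fv_linear | rule slot_linearI
      | simp add: P2_simps tens2_simps bracket_add_left bracket_scale_left fv.scale_right_distrib)+

lemma slot_linear_ad2: "slot_linear scale {} (\<lambda>x. P2 scale {} (ad2 bracket t x))"
proof (rule slot_linearI)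
  fix x y c
  show "P2 scale {} (ad2 bracket t (x + y)) = P2 scale {} (ad2 bracket t x) + P2 scale {} (ad2 bracket t y)"
    by (rule fv_linear_eqI2[where p = t])
      (intro fv_linear | simp add: P2_simps tens2_simps bracket_add_right)+
  show "P2 scale {} (ad2 bracket t (scale c x)) = fv_scale c (P2 scale {} (ad2 bracket t x))"
    by (rule fv_linear_eqI2[where p = t])
      (intro fv_linear | simp add: P2_simps tens2_simps bracket_scale_right fv.scale_right_distrib)+
qed simp

text \<open>The terms with \<open>x\<close> and \<open>y\<close> acting on different factors cancel;
  within one factor the Leibniz rule leaves the action of [x,y].\<close>

lemma ad2_bracket: "P2 scale {} (ad2 bracket t (bracket x y))
  = P2 scale {} (ad2 bracket (ad2 bracket t x) y) - P2 scale {} (ad2 bracket (ad2 bracket t y) x)"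
  by (rule fv_linear_eqI2[where p = t])
    (intro fv_linear | simp add: P2_simps tens2_simps ad2_add bracket_leibniz[of _ x y])+

lemma is_delta_iff: "is_delta scale bracket t d
    \<longleftrightarrow> (\<forall>x. P2 scale {} (d x) = P2 scale {} (ad2 bracket t x))"
  by (simp add: is_delta_def UU_null_def eq_mod_tensor2 delta_eq_ad2 incl2_inject)

text \<open>Every coboundary is a cocycle: carried back to \<ll> \<otimes> \<ll>, the condition
  becomes \<open>ad2_bracket\<close>.\<close>

lemma cocycle_ad2:
  assumes "\<And>x. P2 scale {} (d x) = P2 scale {} (ad2 bracket t x)"
  shows "eq_mod (UU_null scale bracket) (incl2 (d (bracket x y)))
    (comm2 (incl2 (d x)) (comult (fa_gen y)) - comm2 (incl2 (d y)) (comult (fa_gen x)))"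
proof -
  let ?U = "P2 fv_scale (U_null scale bracket)"
  have incl_diff: "incl2 p - incl2 q = incl2 (p - q)" for p q :: "'l \<times> 'l \<Rightarrow>\<^sub>0 'k"
    by (rule fv_linear_diff[symmetric]) (intro fv_linear)
  have "P2 scale {} (d (bracket x y))
      = P2 scale {} (ad2 bracket (d x) y) - P2 scale {} (ad2 bracket (d y) x)"
    using ad2_cong[OF assms[of x]] ad2_cong[OF assms[of y]] by (simp add: assms ad2_bracket)
  then have "?U (incl2 (d (bracket x y))) = ?U (incl2 (ad2 bracket (d x) y - ad2 bracket (d y) x))"
    by (simp add: incl2_inject P2_simps)
  then show ?thesis
    unfolding UU_null_def eq_mod_tensor2
    by (simp add: P2_simps delta_eq_ad2[unfolded delta_def] flip: incl_diff)
qed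

lemma cybe_iff: "eq_mod (UUU_null scale bracket)
      (comm3 (leg12 r) (leg13 r) + comm3 (leg12 r) (leg23 r) + comm3 (leg13 r) (leg23 r)) 0
    \<longleftrightarrow> P3 scale {} (cyb bracket r r) = 0"
proof -
  have "incl3 (0 :: 'l \<times> 'l \<times> 'l \<Rightarrow>\<^sub>0 'k) = 0"
    by (rule fv_linear_zero) (intro fv_linear)
  with incl3_inject[of "cyb bracket r r" 0] show ?thesis
    unfolding UUU_null_def eq_mod_tensor3 cybe_eq_cyb by (simp add: P3_simps)
qed

end

text \<open>Turns the axioms into tensor identities over the Lie algebra. In the converse direction
  linearity of \<open>d\<close> and the cocycle condition are obtained from \<open>d\<close> being a
  coboundary.\<close>

lemma quasi_triangular_iff: "quasi_triangular s br d r \<longleftrightarrow> lie_algebra s br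
    \<and> (\<forall>x. P2 s {} (d x) = P2 s {} (ad2 br r x))
    \<and> (\<forall>x. P2 s {} (tau (d x)) = - P2 s {} (d x))
    \<and> (\<forall>x. P3 s {} (cyc (tensor_id d (d x))) = 0)
    \<and> P3 s {} (cyb br r r) = 0" (is "?L \<longleftrightarrow> ?R")
proof
  assume ?L
  then interpret quasi_triangular s br d r .
  have "\<forall>x. P2 s {} (tau (d x)) = - P2 s {} (d x)"
    using coantisymmetry by (simp add: eq_mod_tensor2 P2_simps)
  moreover have "\<forall>x. P3 s {} (cyc (tensor_id d (d x))) = 0"
    using cojacobi by (simp add: eq_mod_tensor3 cyc_def P3_simps Let_def)
  ultimately show ?R
    using lie_algebra_axioms cobracket_eq_delta cybe by (simp add: is_delta_iff cybe_iff)
next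
  assume R: ?R
  then interpret lie_algebra s br by blast
  show ?L
  proof unfold_locales
    show "linear_into_square s d"
      using R slot_linear_ad2 by (simp add: linear_into_square_iff)
    show "eq_mod (UU_null s br) (incl2 (d (br x y)))
      (comm2 (incl2 (d x)) (comult (fa_gen y)) - comm2 (incl2 (d y)) (comult (fa_gen x)))" for x y
      using R by (intro cocycle_ad2) blast
    show "eq_mod (LL_null s) (tau (d x)) (- d x)" for x
      using R by (simp add: eq_mod_tensor2 P2_simps)
    show "let p = tensor_id d (d x) in eq_mod (LLL_null s) (p + tau12 (tau23 p) + tau23 (tau12 p)) 0" for x
      using R by (simp add: eq_mod_tensor3 cyc_def P3_simps Let_def)
    show "is_delta s br r d"
      using R by (simp add: is_delta_iff)
    show "eq_mod (UUU_null s br)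
          (comm3 (leg12 r) (leg13 r) + comm3 (leg12 r) (leg23 r) + comm3 (leg13 r) (leg23 r)) 0"
      using R by (simp add: cybe_iff)
  qed
qed


section \<open>The semidirect product\<close>

locale equivariant_map = lie_module scale bracket scaleV act
  for scale :: "'k::field_char_0 \<Rightarrow> 'g::ab_group_add \<Rightarrow> 'g" and bracket
    and scaleV :: "'k \<Rightarrow> 'v::ab_group_add \<Rightarrow> 'v" and act +
  fixes f :: "'g \<Rightarrow> 'v"
  assumes f_linear: "Vector_Spaces.linear scale scaleV f"
    and f_equivariant: "f (bracket x y) = act x (f y)"
begin

abbreviation scaleT :: "'k \<Rightarrow> 'v \<times> 'g \<Rightarrow> 'v \<times> 'g"
  where "scaleT \<equiv> module_prod.scale scaleV scale"

abbreviation bracketT :: "'v \<times> 'g \<Rightarrow> 'v \<times> 'g \<Rightarrow> 'v \<times> 'g"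
  where "bracketT \<equiv> semidirect_bracket bracket act"

section \<open>The Lie algebra structure on the semidirect product\<close>

lemma act_simps:
  "act (x + y) v = act x v + act y v" "act x (v + w) = act x v + act x w"
  "act (scale c x) v = scaleV c (act x v)" "act x (scaleV c v) = scaleV c (act x v)"
  using linear_act_left[of v] linear_act_right[of x] by (simp_all add: Vector_Spaces.linear_iff)

lemma act_zero [simp]: "act 0 v = 0" "act x 0 = 0"
  using act_simps(3)[of 0 0 v] act_simps(4)[of x 0 0] by simp_all

lemma act_minus: "act x (- v) = - act x v"
  using act_simps(4)[of x "-1" v] by simp

lemma f_simps: "f (x + y) = f x + f y" "f (scale c x) = scaleV c (f x)"
  using f_linear by (simp_all add: Vector_Spaces.linear_iff)

lemma f_minus: "f (- x) = - f x"
  using f_simps(2)[of "-1" x] by simp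

lemma f_bracket_swap: "f (bracket x y) = - act y (f x)"
  by (subst bracket_antisym) (simp add: f_minus f_equivariant)

sublocale VL: vector_space_prod scaleV scale ..

lemma scaleT_pair: "scaleT c (v, x) = (scaleV c v, scale c x)"
  by (rule VL.scale_prod)

lemma bracketT_pair: "bracketT (v, x) (w, y) = (act x w - act y v, bracket x y)"
  by (simp add: semidirect_bracket_def)

sublocale T: lie_algebra scaleT bracketT
proof (rule lie_algebra.intro)
  show "vector_space scaleT" by (rule VL.p.vector_space_axioms)
  show "lie_algebra_axioms scaleT bracketT"
  proof (rule lie_algebra_axioms.intro)
    show "Vector_Spaces.linear scaleT scaleT (\<lambda>x. bracketT x y)" for y
      unfolding Vector_Spaces.linear_iff
      by (cases y) (simp add: VL.p.vector_space_axioms split_paired_all bracketT_pair scaleT_pair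
        act_simps bracket_add_left bracket_scale_left algebra_simps)
    show "Vector_Spaces.linear scaleT scaleT (\<lambda>y. bracketT x y)" for x
      unfolding Vector_Spaces.linear_iff
      by (cases x) (simp add: VL.p.vector_space_axioms split_paired_all bracketT_pair scaleT_pair
        act_simps bracket_add_right bracket_scale_right algebra_simps)
    show "bracketT x x = 0" for x
      by (cases x) (simp add: bracketT_pair bracket_self zero_prod_def)
    show "bracketT x (bracketT y z) + bracketT y (bracketT z x) + bracketT z (bracketT x y) = 0" for x y z
    proof -
      have "act x (v - w) = act x v - act x w" for x v w
        using act_simps(2)[of x v "- w"] by (simp add: act_minus)
      then show ?thesis
        by (cases x; cases y; cases z)
          (simp add: bracketT_pair act_bracket zero_prod_def jacobi)
    qed
  qed
qed

abbreviation T2 :: "(('v \<times> 'g) \<times> ('v \<times> 'g) \<Rightarrow>\<^sub>0 'k) \<Rightarrow> (('v \<times> 'g) \<times> ('v \<times> 'g) \<Rightarrow>\<^sub>0 'k)"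
  where "T2 \<equiv> P2 scaleT {}"

abbreviation T3 :: "(('v \<times> 'g) \<times> ('v \<times> 'g) \<times> ('v \<times> 'g) \<Rightarrow>\<^sub>0 'k)
      \<Rightarrow> (('v \<times> 'g) \<times> ('v \<times> 'g) \<times> ('v \<times> 'g) \<Rightarrow>\<^sub>0 'k)"
  where "T3 \<equiv> P3 scaleT {}"

abbreviation ff :: "('g \<times> 'g \<Rightarrow>\<^sub>0 'k) \<Rightarrow> (('v \<times> 'g) \<times> ('v \<times> 'g) \<Rightarrow>\<^sub>0 'k)"
  where "ff \<equiv> fv_map (map_prod (inV \<circ> f) (inV \<circ> f))"

section \<open>Derived tensors over the semidirect product\<close>

lemma in_simps:
  "inV (v + w) = (inV v + inV w :: 'v \<times> 'g)" "inL (x + y) = (inL x + inL y :: 'v \<times> 'g)"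
  "inV (scaleV c v) = scaleT c (inV v)" "inL (scale c x) = scaleT c (inL x)"
  "inV (- v) = (- inV v :: 'v \<times> 'g)" "inV 0 = (0 :: 'v \<times> 'g)"
  by (simp_all add: inV_def inL_def scaleT_pair zero_prod_def)

lemma bracketT_in:
  "bracketT (inL x) (inL y) = inL (bracket x y)"
  "bracketT (inL x) (inV v) = inV (act x v)"
  "bracketT (inV v) (inL x) = - inV (act x v)"
  "bracketT (inV v) (inV w) = 0"
  by (simp_all add: inV_def inL_def bracketT_pair zero_prod_def)

text \<open>In terms of \<epsilon>,
  \<open>[x, y\<epsilon>] = [x\<epsilon>, y] = [x,y]\<epsilon>\<close>: equivariance gives the first
  value, antisymmetry the second.\<close>

lemma bracketT_f:
  "bracketT (inL x) (inV (f y)) = inV (f (bracket x y))"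
  "bracketT (inV (f x)) (inL y) = inV (f (bracket x y))"
  by (simp add: bracketT_in f_equivariant) (simp add: bracketT_in f_bracket_swap in_simps)

lemma fv_linear_hat [fv_linear]: "fv_linear F \<Longrightarrow> fv_linear (\<lambda>p. hat f (F p))"
  unfolding hat_def by (intro fv_linear)

lemma hat_single [simp]: "hat f (Poly_Mapping.single (a, b) 1)
    = Poly_Mapping.single (inV (f a), inL b) 1 + Poly_Mapping.single (inL a, inV (f b)) 1"
  by (simp add: hat_def)

lemma hat_add: "hat f (p + q) = hat f p + hat f q"
  by (rule fv_linear_add) (intro fv_linear)

lemma ad2_hat_inL: "T2 (ad2 bracketT (hat f r) (inL x)) = T2 (hat f (ad2 bracket r x))"
  by (rule fv_linear_eqI2[where p = r])
    (intro fv_linear | simp add: ad2_add hat_add bracketT_in(1) bracketT_f P2_simps)+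

text \<open>A bracket with f(x) in the factor i brings in \<open>\<epsilon>\<^sub>i\<close>, and
  \<open>(\<epsilon>\<^sub>1 + \<epsilon>\<^sub>2)\<epsilon>\<^sub>i =
  \<epsilon>\<^sub>1\<epsilon>\<^sub>2\<close> for i = 1, 2.\<close>

lemma ad2_hat_inV: "T2 (ad2 bracketT (hat f r) (inV (f x))) = T2 (ff (ad2 bracket r x))"
  by (rule fv_linear_eqI2[where p = r])
    (intro fv_linear | simp add: ad2_add fv_map_add bracketT_in(4) bracketT_f P2_simps tens2_simps)+

lemma hat_cong:
  assumes "P2 scale {} p = P2 scale {} q"
  shows "T2 (hat f p) = T2 (hat f q)"
  by (rule tensor2_lift[OF _ _ _ assms])
    (intro fv_linear | rule slot_linearI
      | simp add: P2_simps tens2_simps in_simps f_simps fv.scale_right_distrib)+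

lemma ff_cong:
  assumes "P2 scale {} p = P2 scale {} q"
  shows "T2 (ff p) = T2 (ff q)"
  by (rule tensor2_lift[OF _ _ _ assms])
    (intro fv_linear | rule slot_linearI
      | simp add: P2_simps tens2_simps in_simps f_simps fv.scale_right_distrib)+

lemma tau_hat: "tau (hat f p) = hat f (tau p)"
  by (rule fv_linear_eqI2[where p = p])
    (intro fv_linear | simp add: fv_linear_add[OF fv_linear_tau(1)[OF fv_linear_ident]] add.commute)+

lemma tau_ff: "tau (ff p) = ff (tau p)"
  by (rule fv_linear_eqI2[where p = p]) (intro fv_linear | simp)+

text \<open>Multiplication by \<open>e\<^sub>2\<close>. Like \<open>E3\<close>, multiplication by
  \<open>\<epsilon>\<^sub>1\<epsilon>\<^sub>2\<epsilon>\<^sub>3\<close>, it is symmetric in the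
  three factors and so commutes with cyclic permutations (\<open>cyc_E\<close>).\<close>

definition E2 :: "('g \<times> 'g \<times> 'g \<Rightarrow>\<^sub>0 'k) \<Rightarrow> (('v \<times> 'g) \<times> ('v \<times> 'g) \<times> ('v \<times> 'g) \<Rightarrow>\<^sub>0 'k)"
  where "E2 p = fv_map (\<lambda>(a, b, c). (inV (f a), inV (f b), inL c)) p
    + fv_map (\<lambda>(a, b, c). (inV (f a), inL b, inV (f c))) p
    + fv_map (\<lambda>(a, b, c). (inL a, inV (f b), inV (f c))) p"

definition E3 :: "('g \<times> 'g \<times> 'g \<Rightarrow>\<^sub>0 'k) \<Rightarrow> (('v \<times> 'g) \<times> ('v \<times> 'g) \<times> ('v \<times> 'g) \<Rightarrow>\<^sub>0 'k)"
  where "E3 p = fv_map (\<lambda>(a, b, c). (inV (f a), inV (f b), inV (f c))) p"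

lemma fv_linear_E [fv_linear]:
  "fv_linear F \<Longrightarrow> fv_linear (\<lambda>p. E2 (F p))"
  "fv_linear F \<Longrightarrow> fv_linear (\<lambda>p. E3 (F p))"
  unfolding E2_def E3_def by (intro fv_linear; assumption)+

lemma E_add: "E2 (p + q) = E2 p + E2 q" "E3 (p + q) = E3 p + E3 q"
  by (rule fv_linear_add; intro fv_linear)+

lemma E_zero: "E2 0 = 0" "E3 0 = 0"
  by (rule fv_linear_zero; intro fv_linear)+

lemma E_single [simp]:
  "E2 (Poly_Mapping.single (a, b, c) 1) = Poly_Mapping.single (inV (f a), inV (f b), inL c) 1
    + Poly_Mapping.single (inV (f a), inL b, inV (f c)) 1
    + Poly_Mapping.single (inL a, inV (f b), inV (f c)) 1"
  "E3 (Poly_Mapping.single (a, b, c) 1) = Poly_Mapping.single (inV (f a), inV (f b), inV (f c)) 1"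
  by (simp_all add: E2_def E3_def)

lemma E2_cong:
  assumes "P3 scale {} p = P3 scale {} q"
  shows "T3 (E2 p) = T3 (E2 q)"
  by (rule tensor3_lift[OF _ _ _ _ assms])
    (intro fv_linear | rule slot_linearI
      | simp add: P3_simps tens3_simps in_simps f_simps algebra_simps)+

lemma E3_cong:
  assumes "P3 scale {} p = P3 scale {} q"
  shows "T3 (E3 p) = T3 (E3 q)"
  by (rule tensor3_lift[OF _ _ _ _ assms])
    (intro fv_linear | rule slot_linearI
      | simp add: P3_simps tens3_simps in_simps f_simps algebra_simps)+

lemma cyc_E: "cyc (E2 p) = E2 (cyc p)" "cyc (E3 p) = E3 (cyc p)"
  by (rule fv_linear_eqI3[where p = p]; (intro fv_linear | simp add: cyc_add E_add))+

lemma cyb_hat: "T3 (cyb bracketT (hat f r) (hat f r')) = T3 (E2 (cyb bracket r r'))"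
proof (rule fv_linear_eqI2[where p = r])
  fix a b
  show "T3 (cyb bracketT (hat f (Poly_Mapping.single (a, b) 1)) (hat f r'))
      = T3 (E2 (cyb bracket (Poly_Mapping.single (a, b) 1) r'))"
    by (rule fv_linear_eqI2[where p = r'])
      (intro fv_linear | simp add: cyb_add_left cyb_add_right E_add bracketT_in(1,4) bracketT_f
        P3_simps tens3_simps)+
qed (intro fv_linear)+

text \<open>Provides an explicit witness for the existence of the derived cobracket.\<close>

lemma is_hat_cobracket_ad2:
  assumes "is_delta scale bracket r d"
  shows "is_hat_cobracket scaleT f d (ad2 bracketT (hat f r))"
proof -
  have d: "P2 scale {} (ad2 bracket r x) = P2 scale {} (d x)" for x
    using assms by (simp add: is_delta_iff)
  show ?thesis
    unfolding is_hat_cobracket_def linear_into_square_iff eq_mod_tensor2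
    using T.slot_linear_ad2 hat_cong[OF d] ff_cong[OF d] by (simp add: ad2_hat_inL ad2_hat_inV)
qed

section \<open>Transfer of the cobracket axioms to the derived cobracket\<close>

context
  fixes d :: "'g \<Rightarrow> ('g \<times> 'g \<Rightarrow>\<^sub>0 'k)" and h
  assumes h: "is_hat_cobracket scaleT f d h" and surj: "surj f"
begin

lemma hat_cobracket_linear: "linear_into_square scaleT h"
  using h by (simp add: is_hat_cobracket_def)

text \<open>Surjectivity of \<open>f\<close> enters here: every element of \<tt> is x + f(y), so the
  two prescribed kinds of values determine \<open>h\<close> modulo null tensors.\<close>

lemma hat_cobracket_split:
  obtains x y where "z = inL x + inV (f y)" "T2 (h z) = T2 (hat f (d x) + ff (d y))"
proof -
  obtain x v where z: "z = (v, x)" by (cases z) auto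
  from surj obtain y where "v = f y" by (metis surjD)
  with z have z': "z = inL x + inV (f y)" by (simp add: inL_def inV_def)
  have "T2 (h z) = T2 (h (inL x)) + T2 (h (inV (f y)))"
    unfolding z' by (rule slot_linear_add[OF hat_cobracket_linear[unfolded linear_into_square_iff]])
  with h have "T2 (h z) = T2 (hat f (d x) + ff (d y))"
    by (simp add: is_hat_cobracket_def eq_mod_tensor2 P2_simps)
  with z' that show thesis by blast
qed

lemma hat_cobracket_is_delta:
  assumes "is_delta scale bracket r d"
  shows "is_delta scaleT bracketT (hat f r) h"
  unfolding T.is_delta_iff
proof
  fix z
  have d: "P2 scale {} (ad2 bracket r x) = P2 scale {} (d x)" for x
    using assms by (simp add: is_delta_iff)
  obtain x y where z: "z = inL x + inV (f y)" "T2 (h z) = T2 (hat f (d x) + ff (d y))"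
    by (rule hat_cobracket_split)
  have "T2 (ad2 bracketT (hat f r) z)
      = T2 (ad2 bracketT (hat f r) (inL x)) + T2 (ad2 bracketT (hat f r) (inV (f y)))"
    unfolding z(1) by (rule slot_linear_add[OF T.slot_linear_ad2])
  then show "T2 (h z) = T2 (ad2 bracketT (hat f r) z)"
    using z(2) hat_cong[OF d[of x]] ff_cong[OF d[of y]]
    by (simp add: ad2_hat_inL ad2_hat_inV P2_simps)
qed

lemma hat_coantisymmetry:
  assumes d: "\<And>x. P2 scale {} (tau (d x)) = - P2 scale {} (d x)"
  shows "T2 (tau (h z)) = - T2 (h z)"
proof -
  obtain x y where z: "T2 (h z) = T2 (hat f (d x) + ff (d y))"
    by (rule hat_cobracket_split)
  have d': "P2 scale {} (tau (d x)) = P2 scale {} (- d x)" for x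
    by (simp add: d P2_simps)
  have "T2 (tau (h z)) = T2 (tau (hat f (d x) + ff (d y)))"
    by (rule tensor_tau_cong[OF z])
  also have "\<dots> = T2 (hat f (tau (d x))) + T2 (ff (tau (d y)))"
    by (simp add: fv_linear_add[OF fv_linear_tau(1)[OF fv_linear_ident]] tau_hat tau_ff P2_simps)
  also have "\<dots> = T2 (hat f (- d x)) + T2 (ff (- d y))"
    by (simp only: hat_cong[OF d'] ff_cong[OF d'])
  also have "\<dots> = - T2 (h z)"
    unfolding z
    by (simp add: fv_linear_minus[OF fv_linear_hat[OF fv_linear_ident]] fv_linear_minus[OF fv_linear_map] P2_simps)
  finally show ?thesis .
qed

text \<open>On f(a) \<otimes> b the map \<open>h\<close> contributes
  \<open>\<epsilon>\<^sub>1\<epsilon>\<^sub>2\<close>, on a \<otimes> f(b) it contributes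
  \<open>\<epsilon>\<^sub>1 + \<epsilon>\<^sub>2\<close> next to \<open>\<epsilon>\<^sub>3\<close>;
  and \<open>\<epsilon>\<^sub>1\<epsilon>\<^sub>2 + (\<epsilon>\<^sub>1 +
  \<epsilon>\<^sub>2)\<epsilon>\<^sub>3 = e\<^sub>2\<close>.\<close>

lemma tensor_id_hat: "T3 (tensor_id h (hat f q)) = T3 (E2 (tensor_id d q))"
proof (rule fv_linear_eqI2[where p = q])
  fix a b
  let ?m = "\<lambda>c. fv_map (\<lambda>(a1, a2). (a1, a2, c))"
  have "T3 (?m (inL b) (h (inV (f a)))) = T3 (?m (inL b) (ff (d a)))"
    using h by (intro tensor_append_cong) (simp add: is_hat_cobracket_def eq_mod_tensor2)
  moreover have "T3 (?m (inV (f b)) (h (inL a))) = T3 (?m (inV (f b)) (hat f (d a)))"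
    using h by (intro tensor_append_cong) (simp add: is_hat_cobracket_def eq_mod_tensor2)
  moreover have "?m (inL b) (ff p) + ?m (inV (f b)) (hat f p) = E2 (?m b p)" for p
    by (rule fv_linear_eqI2[where p = p]) (intro fv_linear | simp add: fv_map_add add.assoc)+
  ultimately show "T3 (tensor_id h (hat f (Poly_Mapping.single (a, b) 1)))
      = T3 (E2 (tensor_id d (Poly_Mapping.single (a, b) 1)))"
    by (simp add: tensor_id_add P3_simps flip: \<open>\<And>p. _ = E2 (?m b p)\<close>)
qed (intro fv_linear)+

lemma tensor_id_ff: "T3 (tensor_id h (ff q)) = T3 (E3 (tensor_id d q))"
proof (rule fv_linear_eqI2[where p = q])
  fix a b
  let ?m = "\<lambda>c. fv_map (\<lambda>(a1, a2). (a1, a2, c))"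
  have "T3 (?m (inV (f b)) (h (inV (f a)))) = T3 (?m (inV (f b)) (ff (d a)))"
    using h by (intro tensor_append_cong) (simp add: is_hat_cobracket_def eq_mod_tensor2)
  moreover have "?m (inV (f b)) (ff p) = E3 (?m b p)" for p
    by (rule fv_linear_eqI2[where p = p]) (intro fv_linear | simp)+
  ultimately show "T3 (tensor_id h (ff (Poly_Mapping.single (a, b) 1)))
      = T3 (E3 (tensor_id d (Poly_Mapping.single (a, b) 1)))"
    by simp
qed (intro fv_linear)+

lemma hat_cojacobi:
  assumes d: "\<And>x. P3 scale {} (cyc (tensor_id d (d x))) = 0"
  shows "T3 (cyc (tensor_id h (h z))) = 0"
proof -
  obtain x y where z: "T2 (h z) = T2 (hat f (d x) + ff (d y))"
    by (rule hat_cobracket_split)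
  have d': "P3 scale {} (cyc (tensor_id d (d x))) = P3 scale {} 0" for x
    by (simp add: d P3_simps)
  have "T3 (tensor_id h (h z)) = T3 (tensor_id h (hat f (d x) + ff (d y)))"
    by (rule tensor_id_cong[OF hat_cobracket_linear z])
  also have "\<dots> = T3 (E2 (tensor_id d (d x)) + E3 (tensor_id d (d y)))"
    by (simp add: tensor_id_add P3_simps tensor_id_hat tensor_id_ff)
  finally have "T3 (cyc (tensor_id h (h z))) = T3 (cyc (E2 (tensor_id d (d x)) + E3 (tensor_id d (d y))))"
    by (rule tensor_cyc_cong)
  also have "\<dots> = 0"
    using E2_cong[OF d'[of x]] E3_cong[OF d'[of y]]
    by (simp add: cyc_add cyc_E P3_simps E_zero)
  finally show ?thesis .
qed

end

lemma quasi_triangular_hat: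
  assumes qt: "quasi_triangular scale bracket d r" and surj: "surj f"
    and h: "is_hat_cobracket scaleT f d h"
  shows "is_delta scaleT bracketT (hat f r) h" "quasi_triangular scaleT bracketT h (hat f r)"
proof -
  have r: "is_delta scale bracket r d" "\<And>x. P2 scale {} (tau (d x)) = - P2 scale {} (d x)"
    "\<And>x. P3 scale {} (cyc (tensor_id d (d x))) = 0" "P3 scale {} (cyb bracket r r) = 0"
    using qt unfolding quasi_triangular_iff is_delta_iff by blast+
  show 1: "is_delta scaleT bracketT (hat f r) h"
    using hat_cobracket_is_delta[OF h surj r(1)] .
  have "P3 scale {} (cyb bracket r r) = P3 scale {} 0"
    using r(4) by (simp add: P3_simps)
  from E2_cong[OF this] have "T3 (cyb bracketT (hat f r) (hat f r)) = 0"
    by (simp add: cyb_hat E_zero P3_simps)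
  then show "quasi_triangular scaleT bracketT h (hat f r)"
    unfolding quasi_triangular_iff
    using 1 hat_coantisymmetry[OF h surj r(2)] hat_cojacobi[OF h surj r(3)]
    by (simp add: T.is_delta_iff T.lie_algebra_axioms)
qed

text \<open>Makes \<open>quasi_triangular_hat\<close> applicable to a cobracket given as the
  coboundary of \<open>hat f r\<close>: it agrees modulo null tensors with the witness of
  \<open>is_hat_cobracket_ad2\<close>.\<close>

lemma is_delta_imp_is_hat_cobracket:
  assumes "is_delta scale bracket r d" and "is_delta scaleT bracketT (hat f r) h"
  shows "is_hat_cobracket scaleT f d h"
proof -
  have "T2 (h z) = T2 (ad2 bracketT (hat f r) z)" for z
    using assms(2) unfolding T.is_delta_iff by blast
  with is_hat_cobracket_ad2[OF assms(1)] show ?thesis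
    unfolding is_hat_cobracket_def linear_into_square_iff eq_mod_tensor2 by simp
qed

section \<open>Shifts by invariant tensors over V\<close>

context
  fixes \<Omega> :: "'v \<times> 'v \<Rightarrow>\<^sub>0 'k"
  assumes inv: "invariant2 scaleV act \<Omega>"
begin

abbreviation VV :: "('v \<times> 'v \<Rightarrow>\<^sub>0 'k) \<Rightarrow> (('v \<times> 'g) \<times> ('v \<times> 'g) \<Rightarrow>\<^sub>0 'k)"
  where "VV \<equiv> fv_map (map_prod inV inV)"

abbreviation move :: "'g \<Rightarrow> 'v \<times> 'v \<Rightarrow>\<^sub>0 'k"
  where "move x \<equiv> fv_map (map_prod (act x) id) \<Omega> + fv_map (map_prod id (act x)) \<Omega>"

lemma move_null: "P2 scaleV {} (move x) = P2 scaleV {} 0"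
  using inv by (simp add: invariant2_def eq_mod_tensor2)

text \<open>Adding a multiple of \<Omega> therefore leaves the cobracket unchanged. The V-component
  of \<open>z\<close> acts by zero as V is abelian, and the other component by invariance.\<close>

lemma ad2_invariant: "T2 (ad2 bracketT (VV \<Omega>) z) = 0"
proof -
  obtain v x where z: "z = (v, x)" by (cases z)
  have b: "bracketT (inV u) (v, x) = - inV (act x u)" for u
    by (simp add: inV_def bracketT_pair)
  have "T2 (VV (move x)) = T2 (VV 0)"
    by (rule tensor2_lift[OF _ _ _ move_null])
      (intro fv_linear | rule slot_linearI | simp add: P2_simps tens2_simps in_simps)+
  moreover have "T2 (ad2 bracketT (VV \<Omega>) z) = - T2 (VV (move x))"
    unfolding z
    by (rule fv_linear_eqI2[where p = \<Omega>])
      (intro fv_linear | simp add: fv_map_add b P2_simps tens2_simps)+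
  ultimately show ?thesis by (simp add: fv_linear_zero[OF fv_linear_map] P2_simps)
qed

lemma cyb_VV: "T3 (cyb bracketT (VV w) (VV w')) = 0"
proof (rule fv_linear_eqI2[where p = w])
  fix a b
  show "T3 (cyb bracketT (VV (Poly_Mapping.single (a, b) 1)) (VV w')) = 0"
    by (rule fv_linear_eqI2[where p = w'])
      (intro fv_linear | simp add: bracketT_in(4) P3_simps tens3_simps)+
qed (intro fv_linear)+

text \<open>A null tensor stays null when a further factor is inserted at any of the three
  positions.\<close>

lemma insert_move_null:
  "T3 (fv_map (\<lambda>(u, w). (m, inV u, inV w)) (move x)) = 0"
  "T3 (fv_map (\<lambda>(u, w). (inV u, m, inV w)) (move x)) = 0"
  "T3 (fv_map (\<lambda>(u, w). (inV u, inV w, m)) (move x)) = 0"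
proof -
  have "T3 (fv_map (\<lambda>(u, w). (m, inV u, inV w)) (move x)) = T3 (fv_map (\<lambda>(u, w). (m, inV u, inV w)) 0)"
    by (rule tensor2_lift[OF _ _ _ move_null])
      (intro fv_linear | rule slot_linearI | simp add: P3_simps tens3_simps in_simps)+
  then show "T3 (fv_map (\<lambda>(u, w). (m, inV u, inV w)) (move x)) = 0"
    by (simp add: fv_linear_zero[OF fv_linear_map] P3_simps)
  have "T3 (fv_map (\<lambda>(u, w). (inV u, m, inV w)) (move x)) = T3 (fv_map (\<lambda>(u, w). (inV u, m, inV w)) 0)"
    by (rule tensor2_lift[OF _ _ _ move_null])
      (intro fv_linear | rule slot_linearI | simp add: P3_simps tens3_simps in_simps)+
  then show "T3 (fv_map (\<lambda>(u, w). (inV u, m, inV w)) (move x)) = 0"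
    by (simp add: fv_linear_zero[OF fv_linear_map] P3_simps)
  have "T3 (fv_map (\<lambda>(u, w). (inV u, inV w, m)) (move x)) = T3 (fv_map (\<lambda>(u, w). (inV u, inV w, m)) 0)"
    by (rule tensor2_lift[OF _ _ _ move_null])
      (intro fv_linear | rule slot_linearI | simp add: P3_simps tens3_simps in_simps)+
  then show "T3 (fv_map (\<lambda>(u, w). (inV u, inV w, m)) (move x)) = 0"
    by (simp add: fv_linear_zero[OF fv_linear_map] P3_simps)
qed

text \<open>What is left of the mixed Yang--Baxter terms after invariance is used in two adjacent factors;
  invariance around the middle factor relates the two remaining terms.\<close>

definition left_mixed :: "'g \<times> 'g \<Rightarrow> (('v \<times> 'g) \<times> ('v \<times> 'g) \<times> ('v \<times> 'g) \<Rightarrow>\<^sub>0 'k)"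
  where "left_mixed = (\<lambda>(a, b). fv_map (\<lambda>(u, w). (inV (act a u), inV (f b), inV w)) \<Omega>)"

definition right_mixed :: "'g \<times> 'g \<Rightarrow> (('v \<times> 'g) \<times> ('v \<times> 'g) \<times> ('v \<times> 'g) \<Rightarrow>\<^sub>0 'k)"
  where "right_mixed = (\<lambda>(a, b). fv_map (\<lambda>(u, w). (inV u, inV (f a), inV (act b w))) \<Omega>)"

lemma cyb_hat_VV: "T3 (cyb bracketT (hat f r) (VV \<Omega>) + cyb bracketT (VV \<Omega>) (hat f r))
  = T3 (fv_extend left_mixed r - fv_extend right_mixed r)"
proof (rule fv_linear_eqI2[where p = r])
  fix a b
  let ?s = "Poly_Mapping.single (a, b) 1 :: 'g \<times> 'g \<Rightarrow>\<^sub>0 'k"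
  \<comment> \<open>Where \<Omega> fills the last two factors \<open>b\<close> acts on it, and where
    it fills the first two \<open>a\<close> does, which gives the \<open>move\<close> terms. In the
    two remaining terms \<Omega> occupies the outer factors.\<close>
  have "T3 (cyb bracketT (hat f ?s) (VV \<Omega>) + cyb bracketT (VV \<Omega>) (hat f ?s))
    = T3 (left_mixed (a, b) - right_mixed (a, b)
      + fv_map (\<lambda>(u, w). (inV (f a), inV u, inV w)) (move b)
      - fv_map (\<lambda>(u, w). (inV u, inV w, inV (f b))) (move a))"
    unfolding left_mixed_def right_mixed_def
    by (rule fv_linear_eqI2[where p = \<Omega>])
      (intro fv_linear | simp add: fv_map_add cyb_add_left cyb_add_right bracketT_in
        P3_simps tens3_simps)+
  also have "\<dots> = T3 (left_mixed (a, b) - right_mixed (a, b))"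
    by (simp only: P3_simps insert_move_null) simp
  finally show "T3 (cyb bracketT (hat f ?s) (VV \<Omega>) + cyb bracketT (VV \<Omega>) (hat f ?s))
      = T3 (fv_extend left_mixed ?s - fv_extend right_mixed ?s)"
    by simp
qed (intro fv_linear)+

lemma left_mixed_eq: "T3 (fv_extend left_mixed r) = - T3 (fv_extend right_mixed (tau r))"
proof (rule fv_linear_eqI2[where p = r])
  fix a b
  \<comment> \<open>Here \<open>a\<close> acts on the outer factors around f(b). In
    \<open>right_mixed\<close> the acting element is the second component, hence the reversed pair
    and the \<open>tau\<close> in the conclusion.\<close>
  have "left_mixed (a, b) + right_mixed (b, a) = fv_map (\<lambda>(u, w). (inV u, inV (f b), inV w)) (move a)"
    by (simp add: left_mixed_def right_mixed_def fv_map_add fv_map_fv_map case_prod_unfold)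
  then have "T3 (left_mixed (a, b)) + T3 (right_mixed (b, a)) = 0"
    using insert_move_null(2) by (simp flip: fv_linear_add[OF fv_linear_P3])
  then show "T3 (fv_extend left_mixed (Poly_Mapping.single (a, b) 1))
      = - T3 (fv_extend right_mixed (tau (Poly_Mapping.single (a, b) 1)))"
    by (simp add: eq_neg_iff_add_eq_0)
qed (intro fv_linear)+

text \<open>By \<open>left_mixed_eq\<close> the mixed terms add up to minus the extension of
  \<open>right_mixed\<close> at \<open>r + tau r\<close>; that extension is well defined on the
  tensor square, where \<open>r + tau r\<close> is zero.\<close>

lemma cyb_mixed:
  assumes r: "eq_mod (LL_null scale) (r + tau r) 0"
  shows "T3 (cyb bracketT (hat f r) (VV \<Omega>) + cyb bracketT (VV \<Omega>) (hat f r)) = 0"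
proof -
  let ?R = "\<lambda>a b u w. tens3 scaleT {} (inV u) (inV (f a)) (inV (act b w))"
  have R: "T3 (fv_extend right_mixed (Poly_Mapping.single (a, b) 1))
      = fv_extend (\<lambda>(u, w). ?R a b u w) \<Omega>" for a b
    unfolding fv_extend_single right_mixed_def
    by (rule fv_linear_eqI2[where p = \<Omega>]) (intro fv_linear | simp add: tens3_def)+
  have "P2 scale {} (r + tau r) = P2 scale {} 0"
    using r by (simp add: eq_mod_tensor2)
  then have "T3 (fv_extend right_mixed (r + tau r)) = T3 (fv_extend right_mixed 0)"
  proof (rule tensor2_lift[rotated -1])
    show "slot_linear scale {} (\<lambda>a. T3 (fv_extend right_mixed (Poly_Mapping.single (a, b) 1)))" for b
      unfolding R
      by (rule slot_linear_pointwise, rule slot_linearI)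
        (auto simp: tens3_simps in_simps f_simps)
    show "slot_linear scale {} (\<lambda>a. T3 (fv_extend right_mixed (Poly_Mapping.single (b, a) 1)))" for b
      unfolding R
      by (rule slot_linear_pointwise, rule slot_linearI)
        (auto simp: tens3_simps in_simps act_simps)
  qed (intro fv_linear)
  then have "T3 (fv_extend right_mixed r) + T3 (fv_extend right_mixed (tau r)) = 0"
    by (simp add: fv_extend_add fv_linear_zero[OF fv_linear_extend] P3_simps)
  then have "T3 (fv_extend right_mixed (tau r)) = - T3 (fv_extend right_mixed r)"
    by (simp add: add_eq_0_iff)
  then show ?thesis
    unfolding cyb_hat_VV by (simp add: P3_simps left_mixed_eq)
qed

text \<open>Expansion of the Yang-Baxter expression in \<open>c\<close>: the constant term belongs
  to \<open>hat f r\<close>, the linear one vanishes by \<open>cyb_mixed\<close> and the quadratic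
  one by \<open>cyb_VV\<close>. By \<open>ad2_invariant\<close> the map \<open>h\<close> is also the
  coboundary of the shifted tensor.\<close>

lemma quasi_triangular_shift:
  assumes qt: "quasi_triangular scaleT bracketT h (hat f r)"
    and r: "eq_mod (LL_null scale) (r + tau r) 0"
  shows "quasi_triangular scaleT bracketT h (hat f r + fv_scale c (VV \<Omega>))"
proof -
  have "T3 (cyb bracketT (hat f r) (VV \<Omega>)) + T3 (cyb bracketT (VV \<Omega>) (hat f r)) = 0"
    using cyb_mixed[OF r] by (simp add: P3_simps)
  then have "fv_scale c (T3 (cyb bracketT (hat f r) (VV \<Omega>))) + fv_scale c (T3 (cyb bracketT (VV \<Omega>) (hat f r))) = 0"
    by (simp flip: fv.scale_right_distrib)
  with qt show ?thesis
    unfolding quasi_triangular_iff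
    by (simp add: ad2_add ad2_scale cyb_add_left cyb_add_right cyb_scale_left cyb_scale_right
        P2_simps P3_simps ad2_invariant cyb_VV add.commute)
qed

end

end

text \<open>Maps into \<tt> \<otimes> \<tt> are given by representatives, so the cobracket is any
  \<open>h\<close> with the required classes; the existence clause keeps the first part from being
  vacuous.\<close>

theorem proposition6p5:
  fixes scale :: "'k::field_char_0 \<Rightarrow> 'g::ab_group_add \<Rightarrow> 'g"
    and bracket :: "'g \<Rightarrow> 'g \<Rightarrow> 'g"
    and cobracket :: "'g \<Rightarrow> ('g \<times> 'g \<Rightarrow>\<^sub>0 'k)"
    and r :: "'g \<times> 'g \<Rightarrow>\<^sub>0 'k"
    and scaleV :: "'k \<Rightarrow> 'v::ab_group_add \<Rightarrow> 'v"
    and act :: "'g \<Rightarrow> 'v \<Rightarrow> 'v"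
    and f :: "'g \<Rightarrow> 'v"
    and scaleT :: "'k \<Rightarrow> 'v \<times> 'g \<Rightarrow> 'v \<times> 'g"
    and bracketT :: "'v \<times> 'g \<Rightarrow> 'v \<times> 'g \<Rightarrow> 'v \<times> 'g"
    and r_hat :: "('v \<times> 'g) \<times> ('v \<times> 'g) \<Rightarrow>\<^sub>0 'k"
  assumes qt: "quasi_triangular scale bracket cobracket r"
    and V: "lie_module scale bracket scaleV act"
    and f_linear: "Vector_Spaces.linear scale scaleV f"
    and f_equivariant: "\<And>x y. f (bracket x y) = act x (f y)"
    and f_surj: "surj f"
  defines "scaleT \<equiv> module_prod.scale scaleV scale"
    and "bracketT \<equiv> semidirect_bracket bracket act"
    and "r_hat \<equiv> hat f r"
  shows "((\<exists>h. is_hat_cobracket scaleT f cobracket h) \<and>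
      (\<forall>h. is_hat_cobracket scaleT f cobracket h \<longrightarrow>
        is_delta scaleT bracketT r_hat h \<and> quasi_triangular scaleT bracketT h r_hat)) \<and>
    (eq_mod (LL_null scale) (r + tau r) 0 \<longrightarrow>
      (\<forall>\<Omega>. invariant2 scaleV act \<Omega> \<longrightarrow>
        (\<forall>h. is_delta scaleT bracketT r_hat h \<longrightarrow>
          (\<forall>c. quasi_triangular scaleT bracketT h
                 (r_hat + fv_scale c (fv_map (map_prod inV inV) \<Omega>))))))"
proof -
  have equivariant: "equivariant_map scale bracket scaleV act f"
    by (intro equivariant_map.intro equivariant_map_axioms.intro V f_linear f_equivariant)
  have delta: "is_delta scale bracket r cobracket"
    using qt by (rule quasi_triangular.cobracket_eq_delta)
  show ?thesis
    unfolding scaleT_def bracketT_def r_hat_def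
  proof (intro conjI allI impI)
    show "\<exists>h. is_hat_cobracket (module_prod.scale scaleV scale) f cobracket h"
      by (rule exI, rule equivariant_map.is_hat_cobracket_ad2[OF equivariant delta])
  next
    fix h
    assume h: "is_hat_cobracket (module_prod.scale scaleV scale) f cobracket h"
    show "is_delta (module_prod.scale scaleV scale) (semidirect_bracket bracket act) (hat f r) h"
      by (rule equivariant_map.quasi_triangular_hat(1)[OF equivariant qt f_surj h])
    show "quasi_triangular (module_prod.scale scaleV scale) (semidirect_bracket bracket act) h (hat f r)"
      by (rule equivariant_map.quasi_triangular_hat(2)[OF equivariant qt f_surj h])
  next
    fix \<Omega> h c
    assume r: "eq_mod (LL_null scale) (r + tau r) 0" and inv: "invariant2 scaleV act \<Omega>"
      and h: "is_delta (module_prod.scale scaleV scale) (semidirect_bracket bracket act) (hat f r) h"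
    show "quasi_triangular (module_prod.scale scaleV scale) (semidirect_bracket bracket act) h
        (hat f r + fv_scale c (fv_map (map_prod inV inV) \<Omega>))"
      by (rule equivariant_map.quasi_triangular_shift[OF equivariant inv
            equivariant_map.quasi_triangular_hat(2)[OF equivariant qt f_surj
              equivariant_map.is_delta_imp_is_hat_cobracket[OF equivariant delta h]] r])
  qed
qed

end
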